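(* Let $R \subseteq \mathcal{O}(7)$ be a 2-dimensional space of quadratic relations, and let $\mathcal{I} = (R)$ be the operad ideal it generates. Then the rank $r = \dim \mathcal{I}(10)$ of the cubic consequences satisfies $17 \le r \le 22$. In case 1, i.e. when the row canonical form of $R$ is $\begin{bmatrix} 1&0&a&b\\0&1&c&d\end{bmatrix}$, a Zariski dense subset of the space $\mathbb{F}^4$ of parameter values $(a,b,c,d)$ corresponds to rank 22 and hence to operads $\mathcal{O}/\mathcal{I}$ which are nilpotent of index 3; rank 22 (and hence nilpotency of index 3) happens in no other case, i.e. for no $R$ whose row canonical form has its leading 1s in columns other than 1 and 2. The following is a complete list of pairs $(\rho_1,\rho_2)$ of quadratic relations (spanning $R$) for which the rank achieves the minimal value of 17: (1a) $\rho_1 = \phi\circ_1\phi$, $\rho_2 = \phi\circ_2\phi$; (1b) $\rho_1 = \phi\circ_1\phi - \phi\circ_4\phi$, $\rho_2 = \phi\circ_2\phi$; (2a) $\rho_1 = \phi\circ_1\phi$, $\rho_2 = \phi\circ_3\phi$; (2b) $\rho_1 = \phi\circ_1\phi - \phi\circ_4\phi$, $\rho_2 = \phi\circ_3\phi$; (3) $\rho_1 = \phi\circ_1\phi$, $\rho_2 = \phi\circ_4\phi$; (4) $\rho_1 = \phi\circ_2\phi$, $\rho_2 = \phi\circ_3\phi$; (5) $\rho_1 = \phi\circ_2\phi$, $\rho_2 = \phi\circ_4\phi$; (6) $\rho_1 = \phi\circ_3\phi$, $\rho_2 = \phi\circ_4\phi$. That is, a 2-dimensional $R$ has rank 17 if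 and only if $R$ is the span of one of these pairs.
   Context: $\mathbb{F}$ is an algebraically closed field of characteristic 0. $\mathcal{O}$ is the free nonsymmetric operad over $\mathbb{F}$ generated by one quaternary operation $\phi$ (of homological degree 0): $\mathcal{O}(k)$ is the vector space with basis the complete rooted planar 4-ary trees with $k$ leaves (each internal node, labelled $\phi$, has exactly 4 children), and for trees $\alpha,\beta$ of arities $k,\ell$ and $1 \le i \le k$, $\alpha \circ_i \beta$ is the tree of arity $k+\ell-1$ obtained by substituting the root of $\beta$ for the $i$-th leaf of $\alpha$ (leaves counted from left to right), extended bilinearly. $\mathcal{O}(7)$ has ordered basis $\phi\circ_1\phi, \phi\circ_2\phi, \phi\circ_3\phi, \phi\circ_4\phi$; a subspace $R \subseteq \mathcal{O}(7)$ of dimension $r$ is the row space of a unique $r \times 4$ matrix in row canonical form (reduced row echelon form) with respect to this basis. $\mathcal{O}(10)$ has dimension 22, with basis $\phi \circ_i (\phi \circ_j \phi)$ ($1 \le i,j \le 4$) and $(\phi \circ_j \phi) \circ_i \phi$ ($1 \le i < j \le 4$). The operad ideal $\mathcal{I} = (R)$ is the smallest subspace of $\mathcal{O}$ containing $R$ and closed under left and right compositions by arbitrary elements of $\mathcal{O}$; $\mathcal{I}(10) = \mathcal{I} \cap \mathcal{O}(10)$ is spanned by the cubic consequences $\rho \circ_i \phi$ ($1 \le i \le 7$) and $\phi \circ_j \rho$ ($1 \le j \le 4$) of the elements $\rho$ of a basis of $R$. The quotient operad $\mathcal{Q} = \mathcal{O}/\mathcal{I}$ is nilpotent of index 3 if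 every tree monomial involving three occurrences of $\phi$ is zero in $\mathcal{Q}$ (i.e. $\mathcal{I}(10) = \mathcal{O}(10)$) but not every tree monomial involving two occurrences of $\phi$ is zero. *)

theory Defs
  imports
    "HOL-Library.Poly_Mapping"
    "HOL-Computational_Algebra.Polynomial"
    "Jordan_Normal_Form.Gauss_Jordan_Elimination"
begin

section \<open>The free nonsymmetric operad on one quaternary operation\<close>

text \<open>Complete rooted planar 4-ary trees. The trivial tree \<open>Leaf\<close> is the operad identity.\<close>

datatype tree4 = Leaf | Node tree4 tree4 tree4 tree4

fun leaves :: "tree4 \<Rightarrow> nat" where
  "leaves Leaf = 1"
| "leaves (Node a b c d) = leaves a + leaves b + leaves c + leaves d"

fun nodes :: "tree4 \<Rightarrow> nat" where
  "nodes Leaf = 0"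
| "nodes (Node a b c d) = 1 + nodes a + nodes b + nodes c + nodes d"

text \<open>
  \<open>graft t i s\<close> substitutes the root of \<open>s\<close> for the \<open>i\<close>-th leaf of \<open>t\<close>, leaves being counted
  from 1. If \<open>i\<close> is not in the range from 1 to \<open>leaves t\<close>, then \<open>graft t i s = t\<close>; because of the
  truncated subtraction, the index 0 is passed to all subtrees to the right of the one
  containing the \<open>i\<close>-th leaf, so that these remain unchanged.
\<close>

fun graft :: "tree4 \<Rightarrow> nat \<Rightarrow> tree4 \<Rightarrow> tree4" where
  "graft Leaf i s = (if i = 1 then s else Leaf)"
| "graft (Node a b c d) i s =
     Node (graft a i s)
          (graft b (i - leaves a) s)
          (graft c (i - leaves a - leaves b) s)
          (graft d (i - leaves a - leaves b - leaves c) s)"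

lemma graft_outside: "i = 0 \<or> leaves t < i \<Longrightarrow> graft t i s = t"
  by (induction t arbitrary: i) auto

lemma leaves_pos: "0 < leaves t"
  by (induction t) auto

lemma leaves_graft: "1 \<le> i \<Longrightarrow> i \<le> leaves t \<Longrightarrow> leaves (graft t i s) + 1 = leaves t + leaves s"
proof (induction t arbitrary: i)
  case (Node a b c d)
  consider "i \<le> leaves a"
    | "leaves a < i" "i \<le> leaves a + leaves b"
    | "leaves a + leaves b < i" "i \<le> leaves a + leaves b + leaves c"
    | "leaves a + leaves b + leaves c < i"
    by linarith
  then show ?case
  proof cases
    case 1
    then show ?thesis using Node.IH(1)[of i] Node.prems by (simp add: graft_outside)
  next
    case 2
    then show ?thesis using Node.IH(2)[of "i - leaves a"] by (simp add: graft_outside)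
  next
    case 3
    then show ?thesis using Node.IH(3)[of "i - leaves a - leaves b"] by (simp add: graft_outside)
  next
    case 4
    then show ?thesis using Node.IH(4)[of "i - leaves a - leaves b - leaves c"] Node.prems
      by (simp add: graft_outside)
  qed
qed simp

text \<open>
  The underlying vector space of the operad, that is, the direct sum of its homogeneous
  components, consists of all finite formal linear combinations of trees.
\<close>

type_synonym 'f opd = "tree4 \<Rightarrow>\<^sub>0 'f"

definition scale :: "'f::field \<Rightarrow> 'f opd \<Rightarrow> 'f opd" where
  "scale c p = Poly_Mapping.map ((*) c) p"

lemma lookup_scale: "Poly_Mapping.lookup (scale c p) t = c * Poly_Mapping.lookup p t"
  by (simp add: scale_def Poly_Mapping.map.rep_eq when_def)

global_interpretation opd: vector_space "scale :: 'f::field \<Rightarrow> 'f opd \<Rightarrow> 'f opd"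
  by unfold_locales
    (auto intro!: poly_mapping_eqI simp: lookup_scale lookup_add algebra_simps)

definition monomial :: "tree4 \<Rightarrow> 'f::field opd" where
  "monomial t = Poly_Mapping.single t 1"

definition component :: "nat \<Rightarrow> 'f::field opd set" where
  "component k = {p. \<forall>t \<in> Poly_Mapping.keys p. leaves t = k}"

text \<open>
  The bilinear extension of \<open>graft\<close>. It has its intended meaning on \<open>component k\<close>
  for \<open>1 \<le> i \<le> k\<close>.
\<close>

definition circ :: "'f::field opd \<Rightarrow> nat \<Rightarrow> 'f opd \<Rightarrow> 'f opd" where
  "circ p i q =
     (\<Sum>s \<in> Poly_Mapping.keys p. \<Sum>t \<in> Poly_Mapping.keys q.
        scale (Poly_Mapping.lookup p s * Poly_Mapping.lookup q t) (monomial (graft s i t)))"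

definition phi :: "'f::field opd" where
  "phi = monomial (Node Leaf Leaf Leaf Leaf)"

section \<open>Operad ideals and quotients\<close>

definition operad_ideal :: "'f::field opd set \<Rightarrow> bool" where
  "operad_ideal I \<longleftrightarrow> opd.subspace I \<and>
     (\<forall>k l. \<forall>p \<in> I \<inter> component k. \<forall>q \<in> component l.
        (\<forall>i \<in> {1..k}. circ p i q \<in> I) \<and> (\<forall>j \<in> {1..l}. circ q j p \<in> I))"

definition ideal_gen :: "'f::field opd set \<Rightarrow> 'f opd set" where
  "ideal_gen R = \<Inter>{I. operad_ideal I \<and> R \<subseteq> I}"

definition coset :: "'f::field opd set \<Rightarrow> 'f opd \<Rightarrow> 'f opd set" where
  "coset I p = (\<lambda>x. p + x) ` I"

definition quotient_nilpotent :: "'f::field opd set \<Rightarrow> nat \<Rightarrow> bool" where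
  "quotient_nilpotent I n \<longleftrightarrow>
     (\<forall>t. nodes t = n \<longrightarrow> coset I (monomial t) = coset I 0) \<and>
     \<not> (\<forall>t. nodes t = n - 1 \<longrightarrow> coset I (monomial t) = coset I 0)"

section \<open>Quadratic relations\<close>

definition quadratic_relations :: "nat \<Rightarrow> 'f::field opd set \<Rightarrow> bool" where
  "quadratic_relations r R \<longleftrightarrow> opd.subspace R \<and> R \<subseteq> component 7 \<and> opd.dim R = r"

definition cubic_rank :: "'f::field opd set \<Rightarrow> nat" where
  "cubic_rank R = opd.dim (ideal_gen R \<inter> component 10)"

text \<open>
  Rows and columns of matrices are counted from 0, so column \<open>j\<close> is the coefficient of
  the basis element \<open>circ phi (j + 1) phi\<close>.
\<close>

definition quadratic_row_space :: "'f::field mat \<Rightarrow> 'f opd set" where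
  "quadratic_row_space A =
     opd.span ((\<lambda>i. \<Sum>j<4. scale (A $$ (i, j)) (circ phi (j + 1) phi)) ` {..<dim_row A})"

text \<open>
  The library's \<open>row_echelon_form\<close> is the reduced row echelon form; the number of
  rows being \<open>opd.dim R\<close> excludes zero rows.
\<close>

definition row_canonical_form :: "'f::field opd set \<Rightarrow> 'f mat \<Rightarrow> bool" where
  "row_canonical_form R A \<longleftrightarrow>
     A \<in> carrier_mat (opd.dim R) 4 \<and> row_echelon_form A \<and> quadratic_row_space A = R"

section \<open>The Zariski topology on affine space\<close>

text \<open>
  Polynomials in the variables \<open>0, \<dots>, n - 1\<close> are finitely supported families of coefficients
  indexed by exponent vectors; affine \<open>n\<close>-space is \<open>carrier_vec n\<close>.
\<close>

type_synonym 'f mpoly = "(nat \<Rightarrow>\<^sub>0 nat) \<Rightarrow>\<^sub>0 'f"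

definition mpolys :: "nat \<Rightarrow> 'f::field mpoly set" where
  "mpolys n = {p. \<forall>m \<in> Poly_Mapping.keys p. Poly_Mapping.keys m \<subseteq> {..<n}}"

definition mpoly_eval :: "'f::field mpoly \<Rightarrow> 'f vec \<Rightarrow> 'f" where
  "mpoly_eval p x =
     (\<Sum>m \<in> Poly_Mapping.keys p. Poly_Mapping.lookup p m *
        (\<Prod>i \<in> Poly_Mapping.keys m. (x $ i) ^ Poly_Mapping.lookup m i))"

definition zariski_closed :: "nat \<Rightarrow> 'f::field vec set \<Rightarrow> bool" where
  "zariski_closed n Z \<longleftrightarrow>
     (\<exists>P \<subseteq> mpolys n. Z = {x \<in> carrier_vec n. \<forall>p \<in> P. mpoly_eval p x = 0})"

definition zariski_dense :: "nat \<Rightarrow> 'f::field vec set \<Rightarrow> bool" where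
  "zariski_dense n S \<longleftrightarrow>
     S \<subseteq> carrier_vec n \<and> \<Inter>{Z. zariski_closed n Z \<and> S \<subseteq> Z} = carrier_vec n"

end

theory Submission
  imports Defs "Jordan_Normal_Form.Determinant"
begin

text \<open>
  Write \<open>J\<close> for the space of cubic consequences of a pair of relations in row canonical form.
  The dimension of \<open>J\<close> is controlled by the functions on the 22 trees with three nodes that
  annihilate it. Reading each relation as a rewrite rule from its pivot column to the later columns,
  an annihilating function is determined by its values on the five trees without an edge in a pivot
  position, so \<open>J\<close> has dimension at least 17. The remaining constraints on these five values come
  from the trees that can be reduced in two ways. The rank is 17 if and only if all these
  constraints vanish identically, which is a small polynomial system in the parameters, and it is 22
  if and only if the constraints force all five values to be zero. For the pivot columns 1 and 2
  they form a square linear system, whose determinant is a nonzero polynomial in the parameters. For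
  all other pivots one of the five trees occurs in no constraint.
\<close>

section \<open>Dimension bounds by linear functionals\<close>

text \<open>A tree with three nodes has exactly two edges, and each of the 11 + 11 equations that
  \<open>annihilates\<close> imposes for a pair of relations reduces one tree along one edge in a
  pivot position. With two pivot positions, 2 * 2 + 1 = 5 trees have both edges in pivot positions,
  5 have neither and 12 have exactly one. Hence 2 * 5 + 12 = 22 equations, the bound 17 = 22 - 5,
  and five constraints on five unknowns for every pivot pattern. Working with annihilating functions
  avoids row reducing a matrix with parameters, where every choice of a pivot splits into cases.
  Testing against the indicator function of a single irreducible tree isolates one coefficient of
  the constraints at a time, and in a suitable order this yields the polynomial system directly.
  Conversely, an explicit function obtained by rewriting every tree shows that the five values are
  free. The determinant of the generic case is never expanded: one parameter value at which it is
  nonzero suffices.\<close>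

context vector_space
begin

lemma subspace_separation:
  assumes "subspace U" "z \<notin> U"
  obtains f where "Vector_Spaces.linear scale (*) f" "\<forall>x\<in>U. f x = 0" "f z = 1"
proof -
  interpret field_pair: vector_space_pair scale "(*) :: 'a \<Rightarrow> 'a \<Rightarrow> 'a"
    by unfold_locales (auto simp: algebra_simps)
  obtain B where B: "B \<subseteq> U" "independent B" "span B = U"
    using assms(1) by (metis basis_exists span_subspace)
  then have "independent (insert z B)" "z \<notin> B"
    using assms(2) independent_insertI[of z B] span_base by auto
  then obtain f where f: "Vector_Spaces.linear scale (*) f" "\<forall>x\<in>insert z B. f x = (if x = z then 1 else 0)"
    using field_pair.linear_independent_extend[of "insert z B" "\<lambda>x. if x = z then 1 else 0"] by auto
  have "f x = 0" if "x \<in> span B" for x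
    by (rule field_pair.linear_eq_0_on_span[OF f(1) _ that]) (use f(2) \<open>z \<notin> B\<close> in auto)
  with f B(3) that show thesis by auto
qed

lemma spanning_by_functionals:
  assumes "subspace U"
    and "\<And>f. Vector_Spaces.linear scale (*) f \<Longrightarrow> \<forall>x\<in>U. f x = 0 \<Longrightarrow> \<forall>x\<in>V. f x = 0"
  shows "V \<subseteq> U"
  using assms by (metis subsetI subspace_separation zero_neq_one)

lemma finite_basis_exists:
  assumes "finite W" "J \<subseteq> span W"
  obtains B where "B \<subseteq> J" "independent B" "J \<subseteq> span B" "card B = dim J" "finite B"
proof -
  obtain B where "B \<subseteq> J" "independent B" "J \<subseteq> span B" "card B = dim J"
    by (rule basis_exists)
  moreover have "finite B"
    using independent_span_bound[OF assms(1) \<open>independent B\<close>] \<open>B \<subseteq> J\<close> assms(2) by auto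
  ultimately show thesis using that by blast
qed

text \<open>\<open>dim\<close> is the cardinality of a basis, hence 0 for an infinite one, so
  monotonicity requires finite dimension. The trees span an infinite-dimensional space; therefore
  each dimension argument carries a finite spanning set \<open>W\<close>.\<close>

lemma dim_mono_finite: "finite W \<Longrightarrow> V \<subseteq> span W \<Longrightarrow> J \<subseteq> V \<Longrightarrow> dim J \<le> dim V"
  by (metis dim_le_card finite_basis_exists order_trans)

text \<open>A basis of \<open>J\<close> together with \<open>N\<close> spans \<open>V\<close>,
  because a functional that kills both kills \<open>V\<close>. In the equality case this spanning
  set has only \<open>dim V\<close> elements, so it is independent and a functional can be
  prescribed on it: 0 on the part in \<open>J\<close>, \<open>g\<close> on \<open>N\<close>.\<close>

lemma dim_le_dim_plus_card:
  assumes fin: "finite W" "J \<subseteq> span W" "subspace J" "finite N"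
    and ker: "\<And>f. \<lbrakk>Vector_Spaces.linear scale (*) f; \<forall>x\<in>J. f x = 0; \<forall>x\<in>N. f x = 0\<rbrakk> \<Longrightarrow> \<forall>x\<in>V. f x = 0"
  shows "dim V \<le> dim J + card N"
    and "dim V = dim J + card N \<Longrightarrow>
      \<exists>f. Vector_Spaces.linear scale (*) f \<and> (\<forall>x\<in>J. f x = 0) \<and> (\<forall>x\<in>N. f x = g x)"
proof -
  interpret field_pair: vector_space_pair scale "(*) :: 'a \<Rightarrow> 'a \<Rightarrow> 'a"
    by unfold_locales (auto simp: algebra_simps)
  obtain B where B: "B \<subseteq> J" "independent B" "J \<subseteq> span B" "card B = dim J" "finite B"
    using finite_basis_exists[OF fin(1,2)] .
  have V: "V \<subseteq> span (B \<union> N)"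
  proof (rule spanning_by_functionals)
    fix f assume f: "Vector_Spaces.linear scale (*) f" "\<forall>x\<in>span (B \<union> N). f x = 0"
    moreover have "J \<subseteq> span (B \<union> N)" using B(3) span_mono[of B "B \<union> N"] by blast
    ultimately show "\<forall>x\<in>V. f x = 0" by (intro ker) (auto intro: span_base)
  qed simp
  have card_Un: "card (B \<union> N) \<le> dim J + card N" using B(4) card_Un_le by metis
  have "dim V \<le> card (B \<union> N)" using dim_le_card[OF V] B(5) fin(4) by simp
  with card_Un show "dim V \<le> dim J + card N" by simp
  assume dim: "dim V = dim J + card N"
  \<comment> \<open>Equality also leaves no room for an overlap of \<open>B\<close> and
    \<open>N\<close>, so the prescribed values do not conflict.\<close>
  have card_eq: "card (B \<union> N) = card B + card N"
    using \<open>dim V \<le> card (B \<union> N)\<close> card_Un dim B(4) by simp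
  then have disj: "B \<inter> N = {}"
    using card_Un_Int[OF B(5) fin(4)] B(5) by simp
  obtain C where C: "C \<subseteq> B \<union> N" "independent C" "B \<union> N \<subseteq> span C"
    using maximal_independent_subset by metis
  have "V \<subseteq> span C" using V C(3) by (meson order_trans span_minimal subspace_span)
  moreover have "finite C" using C(1) B(5) fin(4) finite_subset by blast
  ultimately have "card (B \<union> N) \<le> card C"
    using dim_le_card[of V C] dim card_eq B(4) by simp
  then have "C = B \<union> N" using C(1) B(5) fin(4) by (simp add: card_seteq)
  then obtain f where f: "Vector_Spaces.linear scale (*) f" "\<forall>x\<in>B \<union> N. f x = (if x \<in> N then g x else 0)"
    using field_pair.linear_independent_extend[OF C(2), of "\<lambda>x. if x \<in> N then g x else 0"] by auto
  have "f x = 0" if "x \<in> span B" for x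
    by (rule field_pair.linear_eq_0_on_span[OF f(1) _ that]) (use f(2) disj in auto)
  with f B(3) show "\<exists>f. Vector_Spaces.linear scale (*) f \<and> (\<forall>x\<in>J. f x = 0) \<and> (\<forall>x\<in>N. f x = g x)"
    by (intro exI[of _ f]) auto
qed

text \<open>This is the converse of the equality case. The functional that is 1 at \<open>n\<close>
  and 0 on \<open>J\<close> and on the rest of \<open>N\<close> shows that \<open>n\<close> is
  outside the span of the other vectors, so a basis of \<open>J\<close> stays independent when
  \<open>N\<close> is added.\<close>

lemma dim_plus_card_le_dim:
  assumes fin: "finite W" "V = span W" "subspace J" "J \<subseteq> V" "N \<subseteq> V" "finite N"
    and ext: "\<And>g. \<exists>f. Vector_Spaces.linear scale (*) f \<and> (\<forall>x\<in>J. f x = 0) \<and> (\<forall>x\<in>N. f x = g x)"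
  shows "dim J + card N \<le> dim V"
proof -
  interpret field_pair: vector_space_pair scale "(*) :: 'a \<Rightarrow> 'a \<Rightarrow> 'a"
    by unfold_locales (auto simp: algebra_simps)
  obtain B where B: "B \<subseteq> J" "independent B" "J \<subseteq> span B" "card B = dim J" "finite B"
    using finite_basis_exists[of W J] fin by metis
  have "independent (B \<union> N') \<and> card (B \<union> N') = card B + card N'" if "N' \<subseteq> N" for N'
    using finite_subset[OF that fin(6)] that
  proof (induction N' rule: finite_induct)
    case (insert n N')
    obtain f where f: "Vector_Spaces.linear scale (*) f" "\<forall>x\<in>J. f x = 0"
      "\<forall>x\<in>N. f x = (if x = n then 1 else 0)"
      using ext[of "\<lambda>x. if x = n then 1 else 0"] by auto
    have "f x = 0" if "x \<in> span (B \<union> N')" for x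
      by (rule field_pair.linear_eq_0_on_span[OF f(1) _ that]) (use f insert B(1) in auto)
    then have "n \<notin> span (B \<union> N')" using f insert by force
    then have "n \<notin> B \<union> N'" "independent (insert n (B \<union> N'))"
      using insert span_base[of n "B \<union> N'"] independent_insertI[of n "B \<union> N'"] by blast+
    then show ?case using insert B(5) by simp
  qed (use B in simp)
  then have "independent (B \<union> N)" "card (B \<union> N) = dim J + card N" using B(4) by auto
  moreover have "B \<union> N \<subseteq> V" using B(1) fin by blast
  ultimately show ?thesis
    using dim_mono_finite[OF fin(1), of V "B \<union> N"] fin(2) dim_eq_card_independent by simp
qed

end

section \<open>Trees and composition\<close>

lemma lookup_monomial: "Poly_Mapping.lookup (monomial t) s = (if s = t then 1 else 0)"
  by (simp add: monomial_def lookup_single when_def)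

lemma keys_monomial: "Poly_Mapping.keys (monomial t :: 'f::field opd) = {t}"
  by (simp add: monomial_def)

lemma component_iff: "p \<in> component k \<longleftrightarrow> (\<forall>t. leaves t \<noteq> k \<longrightarrow> Poly_Mapping.lookup p t = 0)"
  by (auto simp: component_def in_keys_iff)

lemma monomial_in_component: "monomial t \<in> component k \<longleftrightarrow> leaves t = k"
  by (simp add: component_def keys_monomial)

lemma subspace_component: "opd.subspace (component k)"
  by (auto simp: opd.subspace_def component_iff lookup_add lookup_scale)

lemma opd_expansion: "p = (\<Sum>t\<in>Poly_Mapping.keys p. scale (Poly_Mapping.lookup p t) (monomial t))"
proof (rule poly_mapping_eqI)
  fix s
  have "Poly_Mapping.lookup (\<Sum>t\<in>Poly_Mapping.keys p. scale (Poly_Mapping.lookup p t) (monomial t)) s =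
      (\<Sum>t\<in>Poly_Mapping.keys p. if s = t then Poly_Mapping.lookup p t else 0)"
    unfolding lookup_sum by (rule sum.cong) (auto simp: lookup_scale lookup_monomial)
  also have "\<dots> = Poly_Mapping.lookup p s"
    by (simp add: in_keys_iff)
  finally show "Poly_Mapping.lookup p s = Poly_Mapping.lookup
      (\<Sum>t\<in>Poly_Mapping.keys p. scale (Poly_Mapping.lookup p t) (monomial t)) s" ..
qed

lemma component_eq_span: "component k = (opd.span (monomial ` {t. leaves t = k}) :: 'f::field opd set)"
proof
  show "component k \<subseteq> (opd.span (monomial ` {t. leaves t = k}) :: 'f opd set)"
  proof
    fix p :: "'f opd" assume p: "p \<in> component k"
    have "(\<Sum>t\<in>Poly_Mapping.keys p. scale (Poly_Mapping.lookup p t) (monomial t))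
        \<in> opd.span (monomial ` {t. leaves t = k})"
      by (intro opd.span_sum opd.span_scale opd.span_base) (use p in \<open>auto simp: component_def\<close>)
    then show "p \<in> opd.span (monomial ` {t. leaves t = k})"
      by (simp flip: opd_expansion)
  qed
  show "opd.span (monomial ` {t. leaves t = k}) \<subseteq> (component k :: 'f opd set)"
    by (rule opd.span_minimal) (auto simp: monomial_in_component subspace_component)
qed

lemma inj_monomial: "inj (monomial :: tree4 \<Rightarrow> 'f::field opd)"
proof (rule injI)
  fix s t assume "(monomial s :: 'f opd) = monomial t"
  then have "Poly_Mapping.lookup (monomial s :: 'f opd) s = Poly_Mapping.lookup (monomial t) s" by simp
  then show "s = t" by (simp add: lookup_monomial split: if_splits)
qed

lemma independent_monomials: "opd.independent (monomial ` T :: 'f::field opd set)"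
proof (unfold opd.dependent_def, rule notI)
  assume "\<exists>a\<in>monomial ` T. a \<in> opd.span (monomial ` T - {a} :: 'f opd set)"
  then obtain t where t: "t \<in> T" "(monomial t :: 'f opd) \<in> opd.span (monomial ` T - {monomial t})"
    by blast
  have "opd.span (monomial ` T - {monomial t}) \<subseteq> {p :: 'f opd. Poly_Mapping.lookup p t = 0}"
    by (rule opd.span_minimal)
      (auto simp: opd.subspace_def lookup_add lookup_scale lookup_monomial)
  with t show False by (auto simp: lookup_monomial)
qed

lemma dim_component:
  "opd.dim (component k :: 'f::field opd set) = card {t. leaves t = k}"
  unfolding component_eq_span opd.dim_span_eq_card_independent[OF independent_monomials]
  by (rule card_image) (meson inj_monomial inj_on_subset subset_UNIV)

text \<open>The sums in \<open>circ\<close> run over exact supports, which change under addition and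
  scaling. A common finite index set makes both sides of the bilinearity laws comparable term by
  term.\<close>

lemma circ_superset:
  assumes "finite A" "Poly_Mapping.keys p \<subseteq> A" "finite B" "Poly_Mapping.keys q \<subseteq> B"
  shows "circ p i q = (\<Sum>s\<in>A. \<Sum>t\<in>B.
    scale (Poly_Mapping.lookup p s * Poly_Mapping.lookup q t) (monomial (graft s i t)))"
proof -
  have "circ p i q = (\<Sum>s\<in>Poly_Mapping.keys p. \<Sum>t\<in>B.
    scale (Poly_Mapping.lookup p s * Poly_Mapping.lookup q t) (monomial (graft s i t)))"
    unfolding circ_def
    by (intro sum.cong refl sum.mono_neutral_left) (use assms in \<open>auto simp: in_keys_iff\<close>)
  also have "\<dots> = (\<Sum>s\<in>A. \<Sum>t\<in>B.
    scale (Poly_Mapping.lookup p s * Poly_Mapping.lookup q t) (monomial (graft s i t)))"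
    by (intro sum.mono_neutral_left) (use assms in \<open>auto simp: in_keys_iff\<close>)
  finally show ?thesis .
qed

lemma circ_add_left: "circ (p + p') i q = circ p i q + circ p' i q"
proof -
  let ?A = "Poly_Mapping.keys p \<union> Poly_Mapping.keys p'"
  have "Poly_Mapping.keys (p + p') \<subseteq> ?A" by (rule keys_add)
  then show ?thesis
    by (simp add: circ_superset[of ?A _ "Poly_Mapping.keys q"] lookup_add algebra_simps
        opd.scale_left_distrib sum.distrib)
qed

lemma circ_add_right: "circ p i (q + q') = circ p i q + circ p i q'"
proof -
  let ?A = "Poly_Mapping.keys q \<union> Poly_Mapping.keys q'"
  have "Poly_Mapping.keys (q + q') \<subseteq> ?A" by (rule keys_add)
  then show ?thesis
    by (simp add: circ_superset[of "Poly_Mapping.keys p" _ ?A] lookup_add algebra_simps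
        opd.scale_left_distrib sum.distrib)
qed

lemma keys_scale_subset: "Poly_Mapping.keys (scale c p) \<subseteq> Poly_Mapping.keys p"
  by (auto simp: in_keys_iff lookup_scale)

lemma circ_scale_left: "circ (scale c p) i q = scale c (circ p i q)"
  using keys_scale_subset[of c p]
  by (simp add: circ_superset[of "Poly_Mapping.keys p" _ "Poly_Mapping.keys q"] lookup_scale
      opd.scale_sum_right mult.assoc)

lemma circ_scale_right: "circ p i (scale c q) = scale c (circ p i q)"
  using keys_scale_subset[of c q]
  by (simp add: circ_superset[of "Poly_Mapping.keys p" _ "Poly_Mapping.keys q"] lookup_scale
      opd.scale_sum_right mult.left_commute)

lemma circ_zero: "circ 0 i q = 0" "circ p i 0 = 0"
  by (simp_all add: circ_def)

lemma circ_monomial: "circ (monomial s) i (monomial t) = (monomial (graft s i t) :: 'f::field opd)"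
  by (simp add: circ_def keys_monomial lookup_monomial)

lemma circ_in_component:
  assumes "p \<in> component k" "q \<in> component l" "1 \<le> i" "i \<le> k"
  shows "circ p i q \<in> component (k + l - 1)"
proof -
  have "leaves (graft s i t) = k + l - 1" if "s \<in> Poly_Mapping.keys p" "t \<in> Poly_Mapping.keys q" for s t
    using leaves_graft[of i s t] that assms by (auto simp: component_def)
  then show ?thesis
    unfolding circ_def
    by (intro opd.subspace_sum opd.subspace_scale subspace_component)
      (simp add: monomial_in_component)
qed

section \<open>Enumeration of the trees with at most three nodes\<close>

abbreviation corolla :: tree4 where
  "corolla \<equiv> Node Leaf Leaf Leaf Leaf"

lemma leaves_eq: "leaves t = 3 * nodes t + 1"
  by (induction t) auto

lemma nodes_0: "nodes t = 0 \<longleftrightarrow> t = Leaf"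
  by (cases t) auto

lemma nodes_1: "nodes t = Suc 0 \<longleftrightarrow> t = corolla"
  by (cases t) (auto simp: nodes_0)

lemma add_is_2: "m + n = 2 \<longleftrightarrow> m = 2 \<and> n = 0 \<or> m = Suc 0 \<and> n = Suc 0 \<or> m = 0 \<and> n = 2"
  for m n :: nat
  by arith

lemma nodes_2: "nodes t = 2 \<longleftrightarrow> t = graft corolla 1 corolla \<or> t = graft corolla 2 corolla
   \<or> t = graft corolla 3 corolla \<or> t = graft corolla 4 corolla"
proof (cases t)
  case (Node a b c d)
  have "nodes t = 2 \<longleftrightarrow> nodes a + nodes b + nodes c + nodes d = Suc 0" using Node by simp
  then show ?thesis
    unfolding add_is_1 add_is_0 nodes_0 nodes_1 Node by simp blast
qed simp

definition serial :: "nat \<Rightarrow> nat \<Rightarrow> tree4" where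
  "serial i j = graft corolla i (graft corolla j corolla)"

text \<open>Meant for \<open>i < j\<close>: the corolla further to the right is grafted first, so
  that leaf \<open>i\<close> still has index \<open>i\<close> when the other one is
  attached.\<close>

definition parallel :: "nat \<Rightarrow> nat \<Rightarrow> tree4" where
  "parallel i j = graft (graft corolla j corolla) i corolla"

definition cubic_trees :: "tree4 list" where
  "cubic_trees =
    [serial 1 1, serial 1 2, serial 1 3, serial 1 4, serial 2 1, serial 2 2, serial 2 3, serial 2 4,
     serial 3 1, serial 3 2, serial 3 3, serial 3 4, serial 4 1, serial 4 2, serial 4 3, serial 4 4,
     parallel 1 2, parallel 1 3, parallel 1 4, parallel 2 3, parallel 2 4, parallel 3 4]"

lemma nodes_3: "nodes t = 3 \<longleftrightarrow> t \<in> set cubic_trees"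
proof (cases t)
  case (Node a b c d)
  have "nodes t = 3 \<longleftrightarrow> nodes a + nodes b + nodes c + nodes d = 2" using Node by auto
  then show ?thesis
    unfolding add_is_2 add_is_1 add_is_0 nodes_2 nodes_0 nodes_1 Node cubic_trees_def serial_def parallel_def
    by simp (rule iffI; elim disjE conjE; simp)
qed (simp add: cubic_trees_def serial_def parallel_def)

lemma distinct_cubic_trees: "distinct cubic_trees"
  by (simp add: cubic_trees_def serial_def parallel_def)

lemma trees_arity_10: "{t. leaves t = 10} = set cubic_trees"
  using nodes_3 by (auto simp: leaves_eq)

lemma dim_component_10: "opd.dim (component 10 :: 'f::field opd set) = 22"
  unfolding dim_component trees_arity_10 distinct_card[OF distinct_cubic_trees]
  by (simp add: cubic_trees_def)

section \<open>The generated ideal in low arity\<close>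

definition cubic_consequences :: "'f::field opd set \<Rightarrow> 'f opd set" where
  "cubic_consequences R = opd.span
     ((\<Union>\<rho>\<in>R. (\<lambda>m. circ \<rho> m phi) ` {1..7}) \<union> (\<Union>\<rho>\<in>R. (\<lambda>i. circ phi i \<rho>) ` {1..4}))"

lemma subspace_cubic_consequences: "opd.subspace (cubic_consequences R)"
  by (simp add: cubic_consequences_def)

lemma phi_in_component: "phi \<in> component 4"
  by (simp add: phi_def monomial_in_component)

lemma cubic_consequences_subset:
  assumes "R \<subseteq> component 7"
  shows "cubic_consequences R \<subseteq> component 10"
  unfolding cubic_consequences_def
proof (rule opd.span_minimal[OF _ subspace_component], safe)
  fix \<rho> and m :: nat assume "\<rho> \<in> R" "m \<in> {1..7}"
  then show "circ \<rho> m phi \<in> component 10"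
    using circ_in_component[of \<rho> 7 phi 4 m] assms phi_in_component by auto
next
  fix \<rho> and i :: nat assume "\<rho> \<in> R" "i \<in> {1..4}"
  then show "circ phi i \<rho> \<in> component 10"
    using circ_in_component[of phi 4 \<rho> 7 i] assms phi_in_component by auto
qed

lemma component_trivial:
  assumes "p \<in> component k" "p \<noteq> 0"
  shows "k mod 3 = 1"
proof -
  obtain t where "t \<in> Poly_Mapping.keys p" using assms(2) by fastforce
  then show ?thesis using assms(1) by (auto simp: component_def leaves_eq)
qed

lemma component_1: "p \<in> component 1 \<Longrightarrow> \<exists>c. p = scale c (monomial Leaf)"
  by (auto simp: component_iff leaves_eq nodes_0 lookup_scale lookup_monomial
      intro!: exI[of _ "Poly_Mapping.lookup p Leaf"] poly_mapping_eqI)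

lemma component_4: "p \<in> component 4 \<Longrightarrow> \<exists>c. p = scale c phi"
proof (intro exI poly_mapping_eqI)
  fix t assume "p \<in> component 4"
  then show "Poly_Mapping.lookup p t = Poly_Mapping.lookup (scale (Poly_Mapping.lookup p corolla) phi) t"
    by (auto simp: component_iff leaves_eq nodes_1 lookup_scale lookup_monomial phi_def)
qed

lemma graft_Leaf: "graft t i Leaf = t"
  by (induction t arbitrary: i) auto

lemma circ_Leaf_right: "circ p i (monomial Leaf) = p"
  using opd_expansion[of p] by (simp add: circ_def keys_monomial lookup_monomial graft_Leaf)

lemma circ_Leaf_left: "circ (monomial Leaf) 1 p = p"
  using opd_expansion[of p] by (simp add: circ_def keys_monomial lookup_monomial)

lift_definition graded_part :: "nat \<Rightarrow> 'f::field opd \<Rightarrow> 'f opd" is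
  "\<lambda>k p t. if leaves t = k then p t else 0"
  by (rule finite_subset) auto

lemma graded_part_linear:
  "graded_part k 0 = 0"
  "graded_part k (p + q) = graded_part k p + graded_part k q"
  "graded_part k (scale c p) = scale c (graded_part k p)"
  by (auto intro!: poly_mapping_eqI simp: graded_part.rep_eq lookup_add lookup_scale)

lemma graded_part_component:
  "p \<in> component l \<Longrightarrow> graded_part k p = (if k = l then p else 0)"
  by (auto intro!: poly_mapping_eqI simp: graded_part.rep_eq component_iff)

text \<open>Everything of arity at least 13, together with \<open>R\<close> and its cubic consequences, is already
  closed under composition: this determines the generated ideal in arities 7 and 10.\<close>

definition truncated_ideal :: "'f::field opd set \<Rightarrow> 'f opd set" where
  "truncated_ideal R = {p. graded_part 7 p \<in> R \<and> graded_part 10 p \<in> cubic_consequences R \<and>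
     (\<forall>k<7. graded_part k p = 0)}"

lemma truncated_ideal_component:
  assumes "p \<in> component k" "opd.subspace R"
  shows "p \<in> truncated_ideal R \<longleftrightarrow>
    (k < 7 \<longrightarrow> p = 0) \<and> (k = 7 \<longrightarrow> p \<in> R) \<and> (k = 10 \<longrightarrow> p \<in> cubic_consequences R)"
  using assms opd.subspace_0[OF subspace_cubic_consequences[of R]]
  by (auto simp: truncated_ideal_def graded_part_component opd.subspace_0)

lemma operad_ideal_truncated:
  assumes R: "opd.subspace R" "R \<subseteq> component 7"
  shows "operad_ideal (truncated_ideal R)"
  unfolding operad_ideal_def
proof (intro conjI allI ballI)
  show "opd.subspace (truncated_ideal R)"
    using R(1) subspace_cubic_consequences[of R]
    by (auto simp: opd.subspace_def truncated_ideal_def graded_part_linear)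
  fix k l i :: nat and p q :: "'a opd"
  assume p: "p \<in> truncated_ideal R \<inter> component k" and q: "q \<in> component l"
  have sub: "opd.subspace (truncated_ideal R)" by fact
  have zero: "0 \<in> truncated_ideal R" by (rule opd.subspace_0[OF sub])
  have mem: "x \<in> truncated_ideal R" if "x \<in> component m" "m \<ge> 13" for x m
    using that by (simp add: truncated_ideal_component[OF _ R(1)])
  have pcomp: "p \<in> component k" using p by simp
  \<comment> \<open>Nonzero homogeneous elements have arity 1, 4, 7, 10 and so on. With
    \<open>p\<close> of arity at least 7, a composite has arity below 13 only if \<open>q\<close> is
    a multiple of the identity, or \<open>p\<close> is in \<open>R\<close> and \<open>q\<close> is a
    multiple of \<open>phi\<close>; the latter gives a cubic consequence.\<close>
  consider "p = 0 \<or> q = 0" | "k \<ge> 7" "l = 1" | "k = 7" "l = 4" "p \<in> R" | "k + l - 1 \<ge> 13"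
  proof (cases "p = 0 \<or> q = 0")
    case False
    then have "k \<ge> 7" "k mod 3 = 1" "l mod 3 = 1" "k = 7 \<longrightarrow> p \<in> R"
      using p q component_trivial[of p k] component_trivial[of q l]
      by (auto simp: truncated_ideal_component[OF _ R(1)] not_less[symmetric])
    moreover from this have "k = 7 \<or> k \<ge> 10" "l = 1 \<or> l = 4 \<or> l \<ge> 7" by presburger+
    ultimately show thesis using that by linarith
  qed simp
  note cases = this
  show "circ p i q \<in> truncated_ideal R" if i: "i \<in> {1..k}"
  proof (cases rule: cases)
    case 2
    then show ?thesis using component_1[of q] q p opd.subspace_scale[OF sub]
      by (auto simp: circ_scale_right circ_Leaf_right)
  next
    case 3
    then obtain c where c: "q = scale c phi" using component_4 q by blast
    have "circ p i phi \<in> cubic_consequences R"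
      unfolding cubic_consequences_def by (rule opd.span_base) (use 3 i in blast)
    then have "circ p i q \<in> cubic_consequences R"
      using opd.subspace_scale[OF subspace_cubic_consequences] by (simp add: c circ_scale_right)
    moreover have "circ p i q \<in> component 10"
      using circ_in_component[OF pcomp q, of i] i 3 by auto
    ultimately show ?thesis by (simp add: truncated_ideal_component[OF _ R(1)])
  next
    case 4
    then show ?thesis using mem[OF circ_in_component[OF pcomp q]] i by simp
  qed (auto simp: circ_zero zero)
  show "circ q i p \<in> truncated_ideal R" if i: "i \<in> {1..l}"
  proof (cases rule: cases)
    case 2
    then show ?thesis using component_1[of q] q p i opd.subspace_scale[OF sub]
      by (auto simp: circ_scale_left circ_Leaf_left[unfolded One_nat_def])
  next
    case 3
    then obtain c where c: "q = scale c phi" using component_4 q by blast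
    have "circ phi i p \<in> cubic_consequences R"
      unfolding cubic_consequences_def by (rule opd.span_base) (use 3 i in blast)
    then have "circ q i p \<in> cubic_consequences R"
      using opd.subspace_scale[OF subspace_cubic_consequences] by (simp add: c circ_scale_left)
    moreover have "circ q i p \<in> component 10"
      using circ_in_component[OF q pcomp, of i] i 3 by auto
    ultimately show ?thesis by (simp add: truncated_ideal_component[OF _ R(1)])
  next
    case 4
    then show ?thesis using mem[OF circ_in_component[OF q pcomp]] i by (simp add: add.commute)
  qed (auto simp: circ_zero zero)
qed

lemma operad_ideal_ideal_gen: "operad_ideal (ideal_gen R)"
  unfolding ideal_gen_def operad_ideal_def
  by (auto intro!: opd.subspace_Inter)

lemma subset_ideal_gen: "R \<subseteq> ideal_gen R"
  by (auto simp: ideal_gen_def)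

lemma ideal_gen_subset_truncated:
  assumes "opd.subspace R" "R \<subseteq> component 7"
  shows "ideal_gen R \<subseteq> truncated_ideal R"
proof -
  have "R \<subseteq> truncated_ideal R"
    using assms by (auto simp: truncated_ideal_component)
  then show ?thesis
    using operad_ideal_truncated[OF assms] by (auto simp: ideal_gen_def)
qed

lemma ideal_gen_arity_7:
  assumes "opd.subspace R" "R \<subseteq> component 7"
  shows "ideal_gen R \<inter> component 7 = R"
  using ideal_gen_subset_truncated[OF assms] subset_ideal_gen[of R] assms
  by (auto simp: truncated_ideal_component)

lemma ideal_gen_arity_10:
  assumes R: "opd.subspace R" "R \<subseteq> component 7"
  shows "ideal_gen R \<inter> component 10 = cubic_consequences R"
proof
  show "ideal_gen R \<inter> component 10 \<subseteq> cubic_consequences R"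
    using ideal_gen_subset_truncated[OF R] by (auto simp: truncated_ideal_component R)
  have "circ \<rho> m phi \<in> ideal_gen R" if "\<rho> \<in> R" "m \<in> {1..7}" for \<rho> m
    using operad_ideal_ideal_gen[of R] subset_ideal_gen[of R] R(2) that phi_in_component
    unfolding operad_ideal_def by blast
  moreover have "circ phi i \<rho> \<in> ideal_gen R" if "\<rho> \<in> R" "i \<in> {1..4}" for \<rho> i
    using operad_ideal_ideal_gen[of R] subset_ideal_gen[of R] R(2) that phi_in_component
    unfolding operad_ideal_def by blast
  ultimately have "cubic_consequences R \<subseteq> ideal_gen R"
    unfolding cubic_consequences_def using operad_ideal_ideal_gen[of R]
    by (intro opd.span_minimal) (auto simp: operad_ideal_def)
  then show "cubic_consequences R \<subseteq> ideal_gen R \<inter> component 10"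
    using cubic_consequences_subset[OF R(2)] by blast
qed

section \<open>Full rank and nilpotency of the quotient\<close>

lemma coset_eq_iff:
  assumes "opd.subspace I"
  shows "coset I p = coset I 0 \<longleftrightarrow> p \<in> I"
proof
  assume "coset I p = coset I 0"
  moreover have "p \<in> coset I p" using opd.subspace_0[OF assms] by (force simp: coset_def)
  ultimately show "p \<in> I" by (simp add: coset_def)
next
  assume p: "p \<in> I"
  have "x \<in> (\<lambda>x. p + x) ` I" if "x \<in> I" for x
    using opd.subspace_diff[OF assms that p] by (force intro: image_eqI[of _ _ "x - p"])
  then show "coset I p = coset I 0"
    using opd.subspace_add[OF assms p] by (auto simp: coset_def)
qed

lemma component_10_eq_span:
  "component 10 = (opd.span (monomial ` set cubic_trees) :: 'f::field opd set)"
  by (simp add: component_eq_span trees_arity_10)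

lemma cubic_rank_le:
  fixes R :: "'f::field opd set"
  shows "cubic_rank R \<le> 22"
proof -
  have "opd.dim (ideal_gen R \<inter> component 10) \<le> opd.dim (component 10 :: 'f opd set)"
    by (rule opd.dim_mono_finite[of "monomial ` set cubic_trees"])
      (auto simp: component_10_eq_span)
  then show ?thesis
    by (simp add: cubic_rank_def dim_component_10)
qed

lemma cubic_rank_22_iff:
  assumes "opd.subspace R" "R \<subseteq> component 7"
  shows "cubic_rank R = 22 \<longleftrightarrow> component 10 \<subseteq> ideal_gen R"
proof
  let ?W = "monomial ` set cubic_trees :: 'a opd set"
  let ?J = "ideal_gen R \<inter> component 10"
  assume "cubic_rank R = 22"
  moreover have "card ?W = 22"
    using dim_component_10 opd.dim_span_eq_card_independent[OF independent_monomials]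
    by (metis component_10_eq_span)
  ultimately have dim: "opd.dim ?J = card ?W" by (simp add: cubic_rank_def)
  \<comment> \<open>A basis of the intersection already has as many elements as the spanning set of
    22 monomials, so no independent vector \<open>z\<close> can be added to it.\<close>
  show "component 10 \<subseteq> ideal_gen R"
  proof (rule ccontr)
    assume "\<not> component 10 \<subseteq> ideal_gen R"
    then obtain z where z: "z \<in> component 10" "z \<notin> ?J" by blast
    obtain B where B: "B \<subseteq> ?J" "opd.independent B" "?J \<subseteq> opd.span B" "card B = opd.dim ?J" "finite B"
      using opd.finite_basis_exists[of ?W ?J] by (auto simp: component_10_eq_span)
    have "opd.span B \<subseteq> ?J"
      using B(1) operad_ideal_ideal_gen[of R] subspace_component
      by (intro opd.span_minimal opd.subspace_inter) (auto simp: operad_ideal_def)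
    then have "z \<notin> opd.span B" using z by blast
    then have "opd.independent (insert z B)" "z \<notin> B"
      using B(2) opd.independent_insertI opd.span_base by blast+
    moreover have "insert z B \<subseteq> opd.span ?W"
      using B(1) z by (auto simp: component_10_eq_span)
    ultimately have "card (insert z B) \<le> card ?W"
      using opd.independent_span_bound[of ?W "insert z B"] by blast
    then show False using B(4,5) \<open>z \<notin> B\<close> dim by simp
  qed
next
  assume "component 10 \<subseteq> ideal_gen R"
  then show "cubic_rank R = 22"
    by (simp add: cubic_rank_def Int_absorb1 dim_component_10)
qed

text \<open>In arity 7 the ideal is \<open>R\<close> itself, and \<open>r < 4\<close> makes it too
  small to contain all four quadratic trees. So the second half of nilpotency is automatic and only
  arity 10 matters.\<close>

lemma nilpotent_iff:
  assumes "quadratic_relations r R" "r < 4"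
  shows "quotient_nilpotent (ideal_gen R) 3 \<longleftrightarrow> cubic_rank R = 22"
proof -
  have R: "opd.subspace R" "R \<subseteq> component 7" "opd.dim R = r"
    using assms by (auto simp: quadratic_relations_def)
  have sub: "opd.subspace (ideal_gen R)"
    using operad_ideal_ideal_gen by (auto simp: operad_ideal_def)
  have "\<not> (\<forall>t. nodes t = 2 \<longrightarrow> monomial t \<in> ideal_gen R)"
  proof
    assume "\<forall>t. nodes t = 2 \<longrightarrow> monomial t \<in> ideal_gen R"
    then have "\<forall>t. leaves t = 7 \<longrightarrow> monomial t \<in> ideal_gen R \<inter> component 7"
      by (simp add: leaves_eq monomial_in_component)
    then have "\<forall>t. leaves t = 7 \<longrightarrow> monomial t \<in> R"
      unfolding ideal_gen_arity_7[OF R(1,2)] .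
    then have "component 7 \<subseteq> R"
      unfolding component_eq_span
      by (intro opd.span_minimal R) auto
    then have "opd.dim R = card {t. leaves t = 7}"
      using R(2) dim_component[where 'f = 'a, of 7] by auto
    also have "{t. leaves t = 7} = set (map (\<lambda>j. graft corolla j corolla) [1,2,3,4])"
      using nodes_2 by (auto simp: leaves_eq)
    also have "card \<dots> = 4" by (subst distinct_card) auto
    finally show False using R(3) assms(2) by simp
  qed
  moreover have "(\<forall>t. nodes t = 3 \<longrightarrow> monomial t \<in> ideal_gen R) \<longleftrightarrow> component 10 \<subseteq> ideal_gen R"
  proof
    assume "\<forall>t. nodes t = 3 \<longrightarrow> monomial t \<in> ideal_gen R"
    then show "component 10 \<subseteq> ideal_gen R"
      unfolding component_eq_span by (intro opd.span_minimal sub) (auto simp: leaves_eq)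
  next
    assume "component 10 \<subseteq> ideal_gen R"
    then show "\<forall>t. nodes t = 3 \<longrightarrow> monomial t \<in> ideal_gen R"
      by (auto simp: leaves_eq monomial_in_component dest!: subsetD)
  qed
  ultimately show ?thesis
    by (simp add: quotient_nilpotent_def coset_eq_iff[OF sub] cubic_rank_22_iff[OF R(1,2)])
qed

section \<open>Annihilators of the cubic consequences\<close>

definition quadratic :: "'f::field \<Rightarrow> 'f \<Rightarrow> 'f \<Rightarrow> 'f \<Rightarrow> 'f opd" where
  "quadratic a b c d = scale a (circ phi 1 phi) + scale b (circ phi 2 phi) +
     scale c (circ phi 3 phi) + scale d (circ phi 4 phi)"

lemma circ_phi_phi: "circ phi j phi = monomial (graft corolla j corolla)"
  by (simp add: phi_def circ_monomial)

lemma circ_phi_quadratic_monomial: "circ phi i (circ phi j phi) = monomial (serial i j)"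
  by (simp add: phi_def circ_monomial serial_def)

lemma less_5_cases: "1 \<le> j \<Longrightarrow> j \<le> 4 \<Longrightarrow> j = 1 \<or> j = 2 \<or> j = 3 \<or> j = 4" for j :: nat
  by arith

text \<open>In the tree with a corolla on leaf \<open>j\<close>, the leaves \<open>j\<close> to
  \<open>j + 3\<close> belong to the upper corolla. Those to the left keep their number; those to
  the right are shifted by 3, since one leaf was replaced by four.\<close>

lemma circ_quadratic_monomial_phi:
  assumes "1 \<le> j" "j \<le> 4"
  shows "1 \<le> m \<Longrightarrow> m < j \<Longrightarrow> circ (circ phi j phi) m phi = monomial (parallel m j)"
    and "j \<le> m \<Longrightarrow> m \<le> j + 3 \<Longrightarrow> circ (circ phi j phi) m phi = monomial (serial j (m - j + 1))"
    and "j + 3 < m \<Longrightarrow> m \<le> 7 \<Longrightarrow> circ (circ phi j phi) m phi = monomial (parallel j (m - 3))"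
proof -
  show "circ (circ phi j phi) m phi = monomial (parallel m j)"
    by (simp add: phi_def circ_monomial parallel_def)
  show "circ (circ phi j phi) m phi = monomial (serial j (m - j + 1))" if "j \<le> m" "m \<le> j + 3"
  proof -
    have "m = j \<or> m = j + 1 \<or> m = j + 2 \<or> m = j + 3" using that by arith
    then show ?thesis using less_5_cases[OF assms]
      by (elim disjE) (simp_all add: phi_def circ_monomial serial_def)
  qed
  show "circ (circ phi j phi) m phi = monomial (parallel j (m - 3))" if "j + 3 < m" "m \<le> 7"
  proof -
    have "m = 5 \<or> m = 6 \<or> m = 7" using that assms by arith
    then show ?thesis using less_5_cases[OF assms] that
      by (elim disjE) (simp_all add: phi_def circ_monomial parallel_def)
  qed
qed

text \<open>The first four equations come from \<open>circ phi i \<rho>\<close>, the other seven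
  from \<open>circ \<rho> m phi\<close> with \<open>m\<close> from 1 to 7. A tree occurs in both
  groups or twice in the second, according to which of its two edges carries the relation; the
  interaction of the constraints comes from these coincidences.\<close>

definition annihilates :: "(tree4 \<Rightarrow> 'f::field) \<Rightarrow> 'f \<Rightarrow> 'f \<Rightarrow> 'f \<Rightarrow> 'f \<Rightarrow> bool" where
  "annihilates f a b c d \<longleftrightarrow>
     a * f (serial 1 1) + b * f (serial 1 2) + c * f (serial 1 3) + d * f (serial 1 4) = 0 \<and>
     a * f (serial 2 1) + b * f (serial 2 2) + c * f (serial 2 3) + d * f (serial 2 4) = 0 \<and>
     a * f (serial 3 1) + b * f (serial 3 2) + c * f (serial 3 3) + d * f (serial 3 4) = 0 \<and>
     a * f (serial 4 1) + b * f (serial 4 2) + c * f (serial 4 3) + d * f (serial 4 4) = 0 \<and>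
     a * f (serial 1 1) + b * f (parallel 1 2) + c * f (parallel 1 3) + d * f (parallel 1 4) = 0 \<and>
     a * f (serial 1 2) + b * f (serial 2 1) + c * f (parallel 2 3) + d * f (parallel 2 4) = 0 \<and>
     a * f (serial 1 3) + b * f (serial 2 2) + c * f (serial 3 1) + d * f (parallel 3 4) = 0 \<and>
     a * f (serial 1 4) + b * f (serial 2 3) + c * f (serial 3 2) + d * f (serial 4 1) = 0 \<and>
     a * f (parallel 1 2) + b * f (serial 2 4) + c * f (serial 3 3) + d * f (serial 4 2) = 0 \<and>
     a * f (parallel 1 3) + b * f (parallel 2 3) + c * f (serial 3 4) + d * f (serial 4 3) = 0 \<and>
     a * f (parallel 1 4) + b * f (parallel 2 4) + c * f (parallel 3 4) + d * f (serial 4 4) = 0"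

lemma atLeastAtMost_1_4: "{1..4::nat} = {1, 2, 3, 4}"
  by auto

lemma atLeastAtMost_1_7: "{1..7::nat} = {1, 2, 3, 4, 5, 6, 7}"
  by auto

lemma annihilates_iff:
  assumes L: "Vector_Spaces.linear scale (*) L"
  shows "annihilates (\<lambda>t. L (monomial t)) a b c d \<longleftrightarrow>
    (\<forall>m\<in>{1..7}. L (circ (quadratic a b c d) m phi) = 0) \<and>
    (\<forall>i\<in>{1..4}. L (circ phi i (quadratic a b c d)) = 0)"
proof -
  interpret Vector_Spaces.linear scale "(*)" L by fact
  show ?thesis
    unfolding atLeastAtMost_1_4 atLeastAtMost_1_7
    by (simp add: annihilates_def quadratic_def circ_add_left circ_add_right circ_scale_left
        circ_scale_right circ_phi_quadratic_monomial circ_quadratic_monomial_phi add scale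
        conj_ac del: One_nat_def)
qed

text \<open>Composition is linear in \<open>\<rho>\<close>, so the relations whose consequences are
  all killed by \<open>L\<close> form a subspace, and it suffices to test generators.\<close>

lemma vanishes_on_cubic_consequences:
  assumes L: "Vector_Spaces.linear scale (*) L"
  shows "(\<forall>x\<in>cubic_consequences (opd.span S). L x = 0) \<longleftrightarrow>
    (\<forall>\<rho>\<in>S. (\<forall>m\<in>{1..7}. L (circ \<rho> m phi) = 0) \<and> (\<forall>i\<in>{1..4}. L (circ phi i \<rho>) = 0))"
    (is "?l \<longleftrightarrow> ?r")
proof
  interpret L: Vector_Spaces.linear scale "(*)" L by fact
  have "circ \<rho> m phi \<in> cubic_consequences (opd.span S)" if "\<rho> \<in> S" "m \<in> {1..7}" for \<rho> m
    unfolding cubic_consequences_def by (rule opd.span_base) (use that opd.span_base in blast)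
  moreover have "circ phi i \<rho> \<in> cubic_consequences (opd.span S)" if "\<rho> \<in> S" "i \<in> {1..4}" for \<rho> i
    unfolding cubic_consequences_def by (rule opd.span_base) (use that opd.span_base in blast)
  ultimately show ?r if ?l using that by blast
  assume r: ?r
  have "opd.span S \<subseteq> {\<rho>. (\<forall>m\<in>{1..7}. L (circ \<rho> m phi) = 0) \<and> (\<forall>i\<in>{1..4}. L (circ phi i \<rho>) = 0)}"
    by (rule opd.span_minimal)
      (use r in \<open>auto simp: opd.subspace_def circ_zero L.zero circ_add_left circ_add_right
        circ_scale_left circ_scale_right L.add L.scale\<close>)
  then have "cubic_consequences (opd.span S) \<subseteq> {x. L x = 0}"
    unfolding cubic_consequences_def
    by (intro opd.span_minimal) (auto simp: opd.subspace_def L.zero L.add L.scale)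
  then show ?l by blast
qed

lemma linear_on_monomials:
  obtains L where "Vector_Spaces.linear scale (*) L" "\<And>t. L (monomial t) = (f t :: 'f::field)"
proof -
  interpret field_pair: vector_space_pair "scale :: 'f \<Rightarrow> 'f opd \<Rightarrow> 'f opd" "(*) :: 'f \<Rightarrow> 'f \<Rightarrow> 'f"
    by unfold_locales (auto simp: algebra_simps)
  obtain L where "Vector_Spaces.linear scale (*) L" "\<forall>x\<in>range monomial. L x = f (inv_into UNIV monomial x)"
    using field_pair.linear_independent_extend[OF independent_monomials[of UNIV], of "\<lambda>x. f (inv_into UNIV monomial x)"]
    by blast
  with that show thesis by (simp add: inv_f_f[OF inj_monomial])
qed

text \<open>A table of 22 values in the order of \<open>cubic_trees\<close>. Its values at other
  trees are unspecified, which is harmless because \<open>annihilates\<close> only refers to these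
  22.\<close>

definition cubic_function :: "'a list \<Rightarrow> tree4 \<Rightarrow> 'a" where
  "cubic_function v t = the (map_of (zip cubic_trees v) t)"

lemma cubic_function_nth:
  assumes "length v = 22" "k < 22"
  shows "cubic_function v (cubic_trees ! k) = v ! k"
  using map_of_zip_nth[OF _ distinct_cubic_trees, of v k] assms
  by (simp add: cubic_function_def cubic_trees_def)

lemma cubic_function_simps:
  assumes "length v = 22"
  shows
    "cubic_function v (serial 1 1) = v ! 0" "cubic_function v (serial 1 2) = v ! 1"
    "cubic_function v (serial 1 3) = v ! 2" "cubic_function v (serial 1 4) = v ! 3"
    "cubic_function v (serial 2 1) = v ! 4" "cubic_function v (serial 2 2) = v ! 5"
    "cubic_function v (serial 2 3) = v ! 6" "cubic_function v (serial 2 4) = v ! 7"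
    "cubic_function v (serial 3 1) = v ! 8" "cubic_function v (serial 3 2) = v ! 9"
    "cubic_function v (serial 3 3) = v ! 10" "cubic_function v (serial 3 4) = v ! 11"
    "cubic_function v (serial 4 1) = v ! 12" "cubic_function v (serial 4 2) = v ! 13"
    "cubic_function v (serial 4 3) = v ! 14" "cubic_function v (serial 4 4) = v ! 15"
    "cubic_function v (parallel 1 2) = v ! 16" "cubic_function v (parallel 1 3) = v ! 17"
    "cubic_function v (parallel 1 4) = v ! 18" "cubic_function v (parallel 2 3) = v ! 19"
    "cubic_function v (parallel 2 4) = v ! 20" "cubic_function v (parallel 3 4) = v ! 21"
  using cubic_function_nth[OF assms, of 0] cubic_function_nth[OF assms, of 1]
    cubic_function_nth[OF assms, of 2] cubic_function_nth[OF assms, of 3]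
    cubic_function_nth[OF assms, of 4] cubic_function_nth[OF assms, of 5]
    cubic_function_nth[OF assms, of 6] cubic_function_nth[OF assms, of 7]
    cubic_function_nth[OF assms, of 8] cubic_function_nth[OF assms, of 9]
    cubic_function_nth[OF assms, of 10] cubic_function_nth[OF assms, of 11]
    cubic_function_nth[OF assms, of 12] cubic_function_nth[OF assms, of 13]
    cubic_function_nth[OF assms, of 14] cubic_function_nth[OF assms, of 15]
    cubic_function_nth[OF assms, of 16] cubic_function_nth[OF assms, of 17]
    cubic_function_nth[OF assms, of 18] cubic_function_nth[OF assms, of 19]
    cubic_function_nth[OF assms, of 20] cubic_function_nth[OF assms, of 21]
  by (simp_all add: cubic_trees_def)

section \<open>The rank of a pair of relations through its annihilator\<close>

locale quadratic_pair =
  fixes a1 b1 c1 d1 a2 b2 c2 d2 :: "'f::field"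
begin

definition R :: "'f opd set" where
  "R = opd.span {quadratic a1 b1 c1 d1, quadratic a2 b2 c2 d2}"

definition annihilator :: "(tree4 \<Rightarrow> 'f) set" where
  "annihilator = {f. annihilates f a1 b1 c1 d1 \<and> annihilates f a2 b2 c2 d2}"

lemma quadratic_in_component: "quadratic a b c d \<in> component 7"
  unfolding quadratic_def
  by (intro opd.subspace_add opd.subspace_scale subspace_component)
    (auto simp: circ_phi_phi monomial_in_component)

lemma subspace_R: "opd.subspace R"
  by (simp add: R_def)

lemma R_subset: "R \<subseteq> component 7"
  unfolding R_def by (intro opd.span_minimal subspace_component) (auto simp: quadratic_in_component)

lemma cubic_rank_R: "cubic_rank R = opd.dim (cubic_consequences R)"
  by (simp add: cubic_rank_def ideal_gen_arity_10[OF subspace_R R_subset])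

lemma vanishes_iff_annihilator:
  "Vector_Spaces.linear scale (*) L \<Longrightarrow>
    (\<forall>x\<in>cubic_consequences R. L x = 0) \<longleftrightarrow> (\<lambda>t. L (monomial t)) \<in> annihilator"
  by (simp add: R_def vanishes_on_cubic_consequences annihilator_def annihilates_iff)

lemma vanishes_on_component_10:
  assumes "Vector_Spaces.linear scale (*) L"
  shows "(\<forall>x\<in>component 10. L x = 0) \<longleftrightarrow> (\<forall>t\<in>set cubic_trees. L (monomial t) = 0)"
proof
  interpret L: Vector_Spaces.linear scale "(*)" L by fact
  assume "\<forall>t\<in>set cubic_trees. L (monomial t) = 0"
  then show "\<forall>x\<in>component 10. L x = 0"
    using L.eq_0_on_span[of "monomial ` set cubic_trees"] by (auto simp: component_10_eq_span)
qed (auto simp: component_10_eq_span intro: opd.span_base)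

text \<open>A proper subspace of \<open>component 10\<close> is killed by some functional that does
  not vanish on the whole component, and functionals correspond to functions on trees because the
  monomials form a basis.\<close>

lemma rank_22_iff:
  "cubic_rank R = 22 \<longleftrightarrow> (\<forall>f\<in>annihilator. \<forall>t\<in>set cubic_trees. f t = 0)"
  unfolding cubic_rank_22_iff[OF subspace_R R_subset]
proof
  assume *: "component 10 \<subseteq> ideal_gen R"
  show "\<forall>f\<in>annihilator. \<forall>t\<in>set cubic_trees. f t = 0"
  proof
    fix f assume f: "f \<in> annihilator"
    obtain L where L: "Vector_Spaces.linear scale (*) L" "\<And>t. L (monomial t) = f t"
      using linear_on_monomials[of f] by blast
    then have "\<forall>x\<in>component 10. L x = 0"
      using vanishes_iff_annihilator[OF L(1)] f * ideal_gen_arity_10[OF subspace_R R_subset] by auto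
    then show "\<forall>t\<in>set cubic_trees. f t = 0"
      using L by (simp add: vanishes_on_component_10)
  qed
next
  assume *: "\<forall>f\<in>annihilator. \<forall>t\<in>set cubic_trees. f t = 0"
  have "component 10 \<subseteq> cubic_consequences R"
  proof (rule opd.spanning_by_functionals[OF subspace_cubic_consequences])
    fix L :: "'f opd \<Rightarrow> 'f"
    assume "Vector_Spaces.linear scale (*) L" "\<forall>x\<in>cubic_consequences R. L x = 0"
    then show "\<forall>x\<in>component 10. L x = 0"
      using bspec[OF *, of "\<lambda>t. L (monomial t)"]
      by (simp add: vanishes_on_component_10 vanishes_iff_annihilator)
  qed
  then show "component 10 \<subseteq> ideal_gen R"
    using ideal_gen_arity_10[OF subspace_R R_subset] by blast
qed

text \<open>Since \<open>N\<close> determines an annihilating function on all cubic trees, the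
  codimension of the consequences is at most 5. It equals 5 exactly when restriction to
  \<open>N\<close> is onto, that is, when the five values can be chosen freely.\<close>

lemma rank_17:
  assumes N: "N \<subseteq> set cubic_trees" "card N = 5"
    and normal: "\<forall>f\<in>annihilator. (\<forall>t\<in>N. f t = 0) \<longrightarrow> (\<forall>t\<in>set cubic_trees. f t = 0)"
  shows "17 \<le> cubic_rank R"
    and "cubic_rank R = 17 \<longleftrightarrow> (\<forall>g. \<exists>f\<in>annihilator. \<forall>t\<in>N. f t = g t)"
proof -
  let ?C = "component 10 :: 'f opd set" and ?J = "cubic_consequences R"
  let ?W = "monomial ` set cubic_trees :: 'f opd set" and ?N = "monomial ` N :: 'f opd set"
  have fin: "finite ?W" "finite ?N" "finite N" using N(1) finite_subset by auto
  have C: "?C = opd.span ?W" by (rule component_10_eq_span)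
  have J: "opd.subspace ?J" "?J \<subseteq> ?C" "?J \<subseteq> opd.span ?W"
    using subspace_cubic_consequences cubic_consequences_subset[OF R_subset] C by auto
  have cardN: "card ?N = 5"
    using N(2) card_image[OF inj_on_subset[OF inj_monomial subset_UNIV]] by metis
  have ker: "\<forall>x\<in>?C. L x = 0"
    if "Vector_Spaces.linear scale (*) L" "\<forall>x\<in>?J. L x = 0" "\<forall>x\<in>?N. L x = 0" for L
    using bspec[OF normal, of "\<lambda>t. L (monomial t)"] that
    by (simp add: vanishes_on_component_10 vanishes_iff_annihilator)
  have "opd.dim ?C \<le> opd.dim ?J + card ?N"
    by (rule opd.dim_le_dim_plus_card(1)[OF fin(1) J(3,1) fin(2)]) (rule ker)
  then show ge: "17 \<le> cubic_rank R"
    by (simp add: cubic_rank_R dim_component_10 cardN)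
  show "cubic_rank R = 17 \<longleftrightarrow> (\<forall>g. \<exists>f\<in>annihilator. \<forall>t\<in>N. f t = g t)"
  proof (intro iffI allI)
    fix g assume "cubic_rank R = 17"
    then have dim: "opd.dim ?C = opd.dim ?J + card ?N"
      by (simp add: cubic_rank_R dim_component_10 cardN)
    have "\<exists>L. Vector_Spaces.linear scale (*) L \<and> (\<forall>x\<in>?J. L x = 0) \<and>
      (\<forall>x\<in>?N. L x = g (inv_into UNIV monomial x))"
      by (rule opd.dim_le_dim_plus_card(2)[OF fin(1) J(3,1) fin(2) _ dim]) (rule ker)
    then obtain L where L: "Vector_Spaces.linear scale (*) L" "\<forall>x\<in>?J. L x = 0"
      "\<forall>x\<in>?N. L x = g (inv_into UNIV monomial x)" by blast
    then show "\<exists>f\<in>annihilator. \<forall>t\<in>N. f t = g t"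
      by (intro bexI[of _ "\<lambda>t. L (monomial t)"])
        (auto simp: vanishes_iff_annihilator inv_f_f[OF inj_monomial])
  next
    assume ext: "\<forall>g. \<exists>f\<in>annihilator. \<forall>t\<in>N. f t = g t"
    have "opd.dim ?J + card ?N \<le> opd.dim ?C"
    proof (rule opd.dim_plus_card_le_dim[OF fin(1) C J(1,2)])
      show "?N \<subseteq> ?C" using N(1) by (auto simp: C intro: opd.span_base)
      fix g :: "'f opd \<Rightarrow> 'f"
      obtain f where f: "f \<in> annihilator" "\<forall>t\<in>N. f t = g (monomial t)"
        using ext[rule_format, of "\<lambda>t. g (monomial t)"] by blast
      obtain L where "Vector_Spaces.linear scale (*) L" "\<And>t. L (monomial t) = f t"
        using linear_on_monomials[of f] by blast
      with f show "\<exists>L. Vector_Spaces.linear scale (*) L \<and> (\<forall>x\<in>?J. L x = 0) \<and> (\<forall>x\<in>?N. L x = g x)"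
        by (intro exI[of _ L]) (auto simp: vanishes_iff_annihilator)
    qed (rule fin)
    then show "cubic_rank R = 17"
      using ge by (simp add: cubic_rank_R dim_component_10 cardN)
  qed
qed

end

section \<open>The six pivot patterns\<close>

text \<open>
  The parameters are negated, so that a row such as \<open>1 0 (- A) (- B)\<close> reads as the rewrite rule
  \<open>q 1 = A * q 3 + B * q 4\<close>.
\<close>

lemma pivots_12:
  fixes A B C D :: "'f::field"
  shows "17 \<le> cubic_rank (quadratic_pair.R 1 0 (- A) (- B) 0 1 (- C) (- D))"
    and "cubic_rank (quadratic_pair.R 1 0 (- A) (- B) 0 1 (- C) (- D)) = 17 \<longleftrightarrow>
      A = 0 \<and> C = 0 \<and> D = 0 \<and> (B = 0 \<or> B = 1)"
proof -
  interpret quadratic_pair 1 0 "-A" "-B" 0 1 "-C" "-D" .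
  \<comment> \<open>The irreducible trees: both edges are in the non-pivot positions 3 and
    4.\<close>
  let ?N = "{serial 3 3, serial 3 4, serial 4 3, serial 4 4, parallel 3 4}"
  have N: "?N \<subseteq> set cubic_trees" "card ?N = 5"
    by (simp_all add: cubic_trees_def) (simp add: serial_def parallel_def)
  \<comment> \<open>\<open>diff_eq_eq\<close> moves the non-pivot terms to the other side, so that
    the equations act as the rewrite rules and reduce every tree to \<open>?N\<close>.\<close>
  have normal: "\<forall>f\<in>annihilator. (\<forall>t\<in>?N. f t = 0) \<longrightarrow> (\<forall>t\<in>set cubic_trees. f t = 0)"
    by (simp add: annihilator_def annihilates_def cubic_trees_def diff_eq_eq)
  show "17 \<le> cubic_rank R"
    by (rule rank_17(1)[OF N normal])
  show "cubic_rank R = 17 \<longleftrightarrow>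
    A = 0 \<and> C = 0 \<and> D = 0 \<and> (B = 0 \<or> B = 1)"
    unfolding rank_17(2)[OF N normal]
  proof (intro iffI allI)
    assume *: "\<forall>g. \<exists>f\<in>annihilator. \<forall>t\<in>?N. f t = g t"
    \<comment> \<open>The four test functions exploit one ambiguous tree each, and each uses the
      parameters already known to vanish: \<open>parallel 1 2\<close> leaves A at
      \<open>serial 3 3\<close>; \<open>serial 2 2\<close> leaves D at \<open>parallel 3 4\<close>;
      \<open>serial 2 1\<close> leaves the square of C at \<open>serial 3 4\<close>;
      \<open>serial 1 1\<close> leaves B^3 - B^2 at \<open>serial 4 4\<close>.\<close>
    obtain f0 where f0: "f0 \<in> annihilator" "\<forall>t\<in>?N. f0 t = of_bool (t = serial 3 3)"
      using *[rule_format, of "\<lambda>t. of_bool (t = serial 3 3)"] by blast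
    have "f0 (serial 3 3) = 1" "f0 (serial 3 4) = 0" "f0 (serial 4 3) = 0" "f0 (serial 4 4) = 0" "f0 (parallel 3 4) = 0"
      using f0(2) by (simp_all add: serial_def parallel_def)
    with f0(1) have c0: "A = 0"
      unfolding annihilator_def annihilates_def mem_Collect_eq
      by - (elim conjE, simp add: diff_eq_eq)
    obtain f1 where f1: "f1 \<in> annihilator" "\<forall>t\<in>?N. f1 t = of_bool (t = parallel 3 4)"
      using *[rule_format, of "\<lambda>t. of_bool (t = parallel 3 4)"] by blast
    have "f1 (serial 3 3) = 0" "f1 (serial 3 4) = 0" "f1 (serial 4 3) = 0" "f1 (serial 4 4) = 0" "f1 (parallel 3 4) = 1"
      using f1(2) by (simp_all add: serial_def parallel_def)
    with f1(1) have c1: "D = 0"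
      using c0 unfolding annihilator_def annihilates_def mem_Collect_eq
      by - (elim conjE, simp add: diff_eq_eq)
    obtain f2 where f2: "f2 \<in> annihilator" "\<forall>t\<in>?N. f2 t = of_bool (t = serial 3 4)"
      using *[rule_format, of "\<lambda>t. of_bool (t = serial 3 4)"] by blast
    have "f2 (serial 3 3) = 0" "f2 (serial 3 4) = 1" "f2 (serial 4 3) = 0" "f2 (serial 4 4) = 0" "f2 (parallel 3 4) = 0"
      using f2(2) by (simp_all add: serial_def parallel_def)
    with f2(1) have c2: "C = 0"
      using c0 c1 unfolding annihilator_def annihilates_def mem_Collect_eq
      by - (elim conjE, simp add: diff_eq_eq)
    obtain f3 where f3: "f3 \<in> annihilator" "\<forall>t\<in>?N. f3 t = of_bool (t = serial 4 4)"
      using *[rule_format, of "\<lambda>t. of_bool (t = serial 4 4)"] by blast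
    have "f3 (serial 3 3) = 0" "f3 (serial 3 4) = 0" "f3 (serial 4 3) = 0" "f3 (serial 4 4) = 1" "f3 (parallel 3 4) = 0"
      using f3(2) by (simp_all add: serial_def parallel_def)
    with f3(1) have c3: "B = 0 \<or> B = 1"
      using c0 c1 c2 unfolding annihilator_def annihilates_def mem_Collect_eq
      by - (elim conjE, simp add: diff_eq_eq)
    show "A = 0 \<and> C = 0 \<and> D = 0 \<and> (B = 0 \<or> B = 1)"
      using c0 c1 c2 c3 by simp
  next
    fix g :: "tree4 \<Rightarrow> 'f" assume *: "A = 0 \<and> C = 0 \<and> D = 0 \<and> (B = 0 \<or> B = 1)"
    then consider "B = 0" | "B = 1" by blast
    then show "\<exists>f\<in>annihilator. \<forall>t\<in>?N. f t = g t"
    proof cases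
      case 1
      then show ?thesis using *
        by (intro bexI[of _ "cubic_function
         [0, 0, 0, 0,
          0, 0, 0, 0,
          0, 0, g (serial 3 3), g (serial 3 4),
          0, 0, g (serial 4 3), g (serial 4 4),
          0, 0, 0, 0, 0, g (parallel 3 4)]"])
          (simp_all add: quadratic_pair.annihilator_def annihilates_def cubic_function_simps[unfolded One_nat_def])
    next
      \<comment> \<open>Each entry is the result of moving every edge from position 1 to position 4,
        and is 0 as soon as an edge in position 2 occurs.\<close>
      case 2
      then show ?thesis using *
        by (intro bexI[of _ "cubic_function
         [g (serial 4 4), 0, g (parallel 3 4), g (serial 4 4),
          0, 0, 0, 0,
          g (serial 3 4), 0, g (serial 3 3), g (serial 3 4),
          g (serial 4 4), 0, g (serial 4 3), g (serial 4 4),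
          0, g (serial 4 3), g (serial 4 4), 0, 0, g (parallel 3 4)]"])
          (simp_all add: quadratic_pair.annihilator_def annihilates_def cubic_function_simps[unfolded One_nat_def])
    qed
  qed
qed

text \<open>The decisive ambiguous trees are \<open>serial 1 3\<close>, which forces A to vanish,
  then \<open>serial 3 3\<close> for C, then \<open>serial 1 1\<close>, which leaves B^3 = B^2. No
  ambiguity restricts the value at \<open>parallel 2 4\<close>, and this keeps the rank below
  22.\<close>

lemma pivots_13:
  fixes A B C :: "'f::field"
  shows "17 \<le> cubic_rank (quadratic_pair.R 1 (- A) 0 (- B) 0 0 1 (- C))"
    and "cubic_rank (quadratic_pair.R 1 (- A) 0 (- B) 0 0 1 (- C)) = 17 \<longleftrightarrow>
      A = 0 \<and> C = 0 \<and> (B = 0 \<or> B = 1)"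
    and "cubic_rank (quadratic_pair.R 1 (- A) 0 (- B) 0 0 1 (- C)) \<noteq> 22"
proof -
  interpret quadratic_pair 1 "-A" 0 "-B" 0 0 1 "-C" .
  let ?N = "{serial 2 2, serial 2 4, serial 4 2, serial 4 4, parallel 2 4}"
  have N: "?N \<subseteq> set cubic_trees" "card ?N = 5"
    by (simp_all add: cubic_trees_def) (simp add: serial_def parallel_def)
  have normal: "\<forall>f\<in>annihilator. (\<forall>t\<in>?N. f t = 0) \<longrightarrow> (\<forall>t\<in>set cubic_trees. f t = 0)"
    by (simp add: annihilator_def annihilates_def cubic_trees_def diff_eq_eq)
  show "17 \<le> cubic_rank R"
    by (rule rank_17(1)[OF N normal])
  show "cubic_rank R = 17 \<longleftrightarrow>
    A = 0 \<and> C = 0 \<and> (B = 0 \<or> B = 1)"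
    unfolding rank_17(2)[OF N normal]
  proof (intro iffI allI)
    assume *: "\<forall>g. \<exists>f\<in>annihilator. \<forall>t\<in>?N. f t = g t"
    obtain f0 where f0: "f0 \<in> annihilator" "\<forall>t\<in>?N. f0 t = of_bool (t = serial 2 2)"
      using *[rule_format, of "\<lambda>t. of_bool (t = serial 2 2)"] by blast
    have "f0 (serial 2 2) = 1" "f0 (serial 2 4) = 0" "f0 (serial 4 2) = 0" "f0 (serial 4 4) = 0" "f0 (parallel 2 4) = 0"
      using f0(2) by (simp_all add: serial_def parallel_def)
    with f0(1) have c0: "A = 0"
      unfolding annihilator_def annihilates_def mem_Collect_eq
      by - (elim conjE, simp add: diff_eq_eq)
    obtain f1 where f1: "f1 \<in> annihilator" "\<forall>t\<in>?N. f1 t = of_bool (t = serial 4 2)"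
      using *[rule_format, of "\<lambda>t. of_bool (t = serial 4 2)"] by blast
    have "f1 (serial 2 2) = 0" "f1 (serial 2 4) = 0" "f1 (serial 4 2) = 1" "f1 (serial 4 4) = 0" "f1 (parallel 2 4) = 0"
      using f1(2) by (simp_all add: serial_def parallel_def)
    with f1(1) have c1: "C = 0"
      using c0 unfolding annihilator_def annihilates_def mem_Collect_eq
      by - (elim conjE, simp add: diff_eq_eq)
    obtain f2 where f2: "f2 \<in> annihilator" "\<forall>t\<in>?N. f2 t = of_bool (t = serial 4 4)"
      using *[rule_format, of "\<lambda>t. of_bool (t = serial 4 4)"] by blast
    have "f2 (serial 2 2) = 0" "f2 (serial 2 4) = 0" "f2 (serial 4 2) = 0" "f2 (serial 4 4) = 1" "f2 (parallel 2 4) = 0"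
      using f2(2) by (simp_all add: serial_def parallel_def)
    with f2(1) have c2: "B = 0 \<or> B = 1"
      using c0 c1 unfolding annihilator_def annihilates_def mem_Collect_eq
      by - (elim conjE, simp add: diff_eq_eq)
    show "A = 0 \<and> C = 0 \<and> (B = 0 \<or> B = 1)"
      using c0 c1 c2 by simp
  next
    fix g :: "tree4 \<Rightarrow> 'f" assume *: "A = 0 \<and> C = 0 \<and> (B = 0 \<or> B = 1)"
    then consider "B = 0" | "B = 1" by blast
    then show "\<exists>f\<in>annihilator. \<forall>t\<in>?N. f t = g t"
    proof cases
      case 1
      then show ?thesis using *
        by (intro bexI[of _ "cubic_function
         [0, 0, 0, 0,
          0, g (serial 2 2), 0, g (serial 2 4),
          0, 0, 0, 0,
          0, g (serial 4 2), 0, g (serial 4 4),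
          0, 0, 0, 0, g (parallel 2 4), 0]"])
          (simp_all add: quadratic_pair.annihilator_def annihilates_def cubic_function_simps[unfolded One_nat_def])
    next
      case 2
      then show ?thesis using *
        by (intro bexI[of _ "cubic_function
         [g (serial 4 4), g (parallel 2 4), 0, g (serial 4 4),
          g (serial 2 4), g (serial 2 2), 0, g (serial 2 4),
          0, 0, 0, 0,
          g (serial 4 4), g (serial 4 2), 0, g (serial 4 4),
          g (serial 4 2), 0, g (serial 4 4), 0, g (parallel 2 4), 0]"])
          (simp_all add: quadratic_pair.annihilator_def annihilates_def cubic_function_simps[unfolded One_nat_def])
    qed
  qed
  \<comment> \<open>The indicator of the irreducible tree \<open>parallel 2 4\<close>, propagated
    along the rules. It is consistent for all parameters: both reductions of
    \<open>serial 1 1\<close> give A * B and both reductions of \<open>parallel 1 3\<close> give A *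
    C.\<close>
  let ?f = "cubic_function
         [A * B, B, 0, 0,
          0, 0, 0, 0,
          0, 0, 0, 0,
          0, 0, 0, 0,
          0, A * C, A, C, 1, 0]"
  have "?f \<in> annihilator" "?f (parallel 2 4) \<noteq> (0 :: 'f)"
    by (simp_all add: quadratic_pair.annihilator_def annihilates_def cubic_function_simps[unfolded One_nat_def])
  moreover have "parallel 2 4 \<in> set cubic_trees"
    by (simp add: cubic_trees_def)
  ultimately show "cubic_rank R \<noteq> 22"
    unfolding rank_22_iff by blast
qed

text \<open>The tree \<open>serial 1 4\<close> is 0 by its upper edge, while its root edge reduces
  it to A times \<open>serial 2 3\<close> plus B times \<open>serial 3 2\<close>. The free
  irreducible tree is now \<open>parallel 2 3\<close>.\<close>

lemma pivots_14:
  fixes A B :: "'f::field"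
  shows "17 \<le> cubic_rank (quadratic_pair.R 1 (- A) (- B) 0 0 0 0 1)"
    and "cubic_rank (quadratic_pair.R 1 (- A) (- B) 0 0 0 0 1) = 17 \<longleftrightarrow>
      A = 0 \<and> B = 0"
    and "cubic_rank (quadratic_pair.R 1 (- A) (- B) 0 0 0 0 1) \<noteq> 22"
proof -
  interpret quadratic_pair 1 "-A" "-B" 0 0 0 0 1 .
  let ?N = "{serial 2 2, serial 2 3, serial 3 2, serial 3 3, parallel 2 3}"
  have N: "?N \<subseteq> set cubic_trees" "card ?N = 5"
    by (simp_all add: cubic_trees_def) (simp add: serial_def parallel_def)
  have normal: "\<forall>f\<in>annihilator. (\<forall>t\<in>?N. f t = 0) \<longrightarrow> (\<forall>t\<in>set cubic_trees. f t = 0)"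
    by (simp add: annihilator_def annihilates_def cubic_trees_def diff_eq_eq)
  show "17 \<le> cubic_rank R"
    by (rule rank_17(1)[OF N normal])
  show "cubic_rank R = 17 \<longleftrightarrow>
    A = 0 \<and> B = 0"
    unfolding rank_17(2)[OF N normal]
  proof (intro iffI allI)
    assume *: "\<forall>g. \<exists>f\<in>annihilator. \<forall>t\<in>?N. f t = g t"
    obtain f0 where f0: "f0 \<in> annihilator" "\<forall>t\<in>?N. f0 t = of_bool (t = serial 2 3)"
      using *[rule_format, of "\<lambda>t. of_bool (t = serial 2 3)"] by blast
    have "f0 (serial 2 2) = 0" "f0 (serial 2 3) = 1" "f0 (serial 3 2) = 0" "f0 (serial 3 3) = 0" "f0 (parallel 2 3) = 0"
      using f0(2) by (simp_all add: serial_def parallel_def)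
    with f0(1) have c0: "A = 0"
      unfolding annihilator_def annihilates_def mem_Collect_eq
      by - (elim conjE, simp add: diff_eq_eq)
    obtain f1 where f1: "f1 \<in> annihilator" "\<forall>t\<in>?N. f1 t = of_bool (t = serial 3 2)"
      using *[rule_format, of "\<lambda>t. of_bool (t = serial 3 2)"] by blast
    have "f1 (serial 2 2) = 0" "f1 (serial 2 3) = 0" "f1 (serial 3 2) = 1" "f1 (serial 3 3) = 0" "f1 (parallel 2 3) = 0"
      using f1(2) by (simp_all add: serial_def parallel_def)
    with f1(1) have c1: "B = 0"
      using c0 unfolding annihilator_def annihilates_def mem_Collect_eq
      by - (elim conjE, simp add: diff_eq_eq)
    show "A = 0 \<and> B = 0"
      using c0 c1 by simp
  next
    fix g :: "tree4 \<Rightarrow> 'f" assume *: "A = 0 \<and> B = 0"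
    then show "\<exists>f\<in>annihilator. \<forall>t\<in>?N. f t = g t"
      by (intro bexI[of _ "cubic_function
         [0, 0, 0, 0,
          0, g (serial 2 2), g (serial 2 3), 0,
          0, g (serial 3 2), g (serial 3 3), 0,
          0, 0, 0, 0,
          0, 0, 0, g (parallel 2 3), 0, 0]"])
        (simp_all add: quadratic_pair.annihilator_def annihilates_def cubic_function_simps[unfolded One_nat_def])
  qed
  let ?f = "cubic_function
         [A * B, B, 0, 0,
          0, 0, 0, 0,
          0, 0, 0, 0,
          0, 0, 0, 0,
          0, A, 0, 1, 0, 0]"
  have "?f \<in> annihilator" "?f (parallel 2 3) \<noteq> (0 :: 'f)"
    by (simp_all add: quadratic_pair.annihilator_def annihilates_def cubic_function_simps[unfolded One_nat_def])
  moreover have "parallel 2 3 \<in> set cubic_trees"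
    by (simp add: cubic_trees_def)
  ultimately show "cubic_rank R \<noteq> 22"
    unfolding rank_22_iff by blast
qed

text \<open>Reducing the root edges of \<open>serial 2 3\<close> and \<open>serial 3 2\<close> gives
  A and B times \<open>serial 4 1\<close>, while their upper edges lead to multiples of
  \<open>serial 4 4\<close>. So a single test function forces both parameters to vanish.\<close>

lemma pivots_23:
  fixes A B :: "'f::field"
  shows "17 \<le> cubic_rank (quadratic_pair.R 0 1 0 (- A) 0 0 1 (- B))"
    and "cubic_rank (quadratic_pair.R 0 1 0 (- A) 0 0 1 (- B)) = 17 \<longleftrightarrow>
      A = 0 \<and> B = 0"
    and "cubic_rank (quadratic_pair.R 0 1 0 (- A) 0 0 1 (- B)) \<noteq> 22"
proof -
  interpret quadratic_pair 0 1 0 "-A" 0 0 1 "-B" .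
  let ?N = "{serial 1 1, serial 1 4, serial 4 1, serial 4 4, parallel 1 4}"
  have N: "?N \<subseteq> set cubic_trees" "card ?N = 5"
    by (simp_all add: cubic_trees_def) (simp add: serial_def parallel_def)
  have normal: "\<forall>f\<in>annihilator. (\<forall>t\<in>?N. f t = 0) \<longrightarrow> (\<forall>t\<in>set cubic_trees. f t = 0)"
    by (simp add: annihilator_def annihilates_def cubic_trees_def diff_eq_eq)
  show "17 \<le> cubic_rank R"
    by (rule rank_17(1)[OF N normal])
  show "cubic_rank R = 17 \<longleftrightarrow>
    A = 0 \<and> B = 0"
    unfolding rank_17(2)[OF N normal]
  proof (intro iffI allI)
    assume *: "\<forall>g. \<exists>f\<in>annihilator. \<forall>t\<in>?N. f t = g t"
    obtain f0 where f0: "f0 \<in> annihilator" "\<forall>t\<in>?N. f0 t = of_bool (t = serial 4 1)"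
      using *[rule_format, of "\<lambda>t. of_bool (t = serial 4 1)"] by blast
    have "f0 (serial 1 1) = 0" "f0 (serial 1 4) = 0" "f0 (serial 4 1) = 1" "f0 (serial 4 4) = 0" "f0 (parallel 1 4) = 0"
      using f0(2) by (simp_all add: serial_def parallel_def)
    with f0(1) have c0: "A = 0 \<and> B = 0"
      unfolding annihilator_def annihilates_def mem_Collect_eq
      by - (elim conjE, simp add: diff_eq_eq)
    show "A = 0 \<and> B = 0"
      using c0 by simp
  next
    fix g :: "tree4 \<Rightarrow> 'f" assume *: "A = 0 \<and> B = 0"
    then show "\<exists>f\<in>annihilator. \<forall>t\<in>?N. f t = g t"
      by (intro bexI[of _ "cubic_function
         [g (serial 1 1), 0, 0, g (serial 1 4),
          0, 0, 0, 0,
          0, 0, 0, 0,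
          g (serial 4 1), 0, 0, g (serial 4 4),
          0, 0, g (parallel 1 4), 0, 0, 0]"])
        (simp_all add: quadratic_pair.annihilator_def annihilates_def cubic_function_simps[unfolded One_nat_def])
  qed
  \<comment> \<open>In \<open>annihilates\<close> the tree \<open>serial 1 1\<close> only occurs
    with the first coefficient, which is 0 in both relations, so its indicator is an annihilating
    function.\<close>
  let ?f = "cubic_function
         [1, 0, 0, 0,
          0, 0, 0, 0,
          0, 0, 0, 0,
          0, 0, 0, 0,
          0, 0, 0, 0, 0, 0]"
  have "?f \<in> annihilator" "?f (serial 1 1) \<noteq> (0 :: 'f)"
    by (simp_all add: quadratic_pair.annihilator_def annihilates_def cubic_function_simps[unfolded One_nat_def])
  moreover have "serial 1 1 \<in> set cubic_trees"
    by (simp add: cubic_trees_def)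
  ultimately show "cubic_rank R \<noteq> 22"
    unfolding rank_22_iff by blast
qed

text \<open>The tree \<open>serial 2 4\<close> is 0 by its upper edge and A times
  \<open>serial 3 3\<close> by its root edge.\<close>

lemma pivots_24:
  fixes A :: "'f::field"
  shows "17 \<le> cubic_rank (quadratic_pair.R 0 1 (- A) 0 0 0 0 1)"
    and "cubic_rank (quadratic_pair.R 0 1 (- A) 0 0 0 0 1) = 17 \<longleftrightarrow>
      A = 0"
    and "cubic_rank (quadratic_pair.R 0 1 (- A) 0 0 0 0 1) \<noteq> 22"
proof -
  interpret quadratic_pair 0 1 "-A" 0 0 0 0 1 .
  let ?N = "{serial 1 1, serial 1 3, serial 3 1, serial 3 3, parallel 1 3}"
  have N: "?N \<subseteq> set cubic_trees" "card ?N = 5"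
    by (simp_all add: cubic_trees_def) (simp add: serial_def parallel_def)
  have normal: "\<forall>f\<in>annihilator. (\<forall>t\<in>?N. f t = 0) \<longrightarrow> (\<forall>t\<in>set cubic_trees. f t = 0)"
    by (simp add: annihilator_def annihilates_def cubic_trees_def diff_eq_eq)
  show "17 \<le> cubic_rank R"
    by (rule rank_17(1)[OF N normal])
  show "cubic_rank R = 17 \<longleftrightarrow>
    A = 0"
    unfolding rank_17(2)[OF N normal]
  proof (intro iffI allI)
    assume *: "\<forall>g. \<exists>f\<in>annihilator. \<forall>t\<in>?N. f t = g t"
    obtain f0 where f0: "f0 \<in> annihilator" "\<forall>t\<in>?N. f0 t = of_bool (t = serial 3 3)"
      using *[rule_format, of "\<lambda>t. of_bool (t = serial 3 3)"] by blast
    have "f0 (serial 1 1) = 0" "f0 (serial 1 3) = 0" "f0 (serial 3 1) = 0" "f0 (serial 3 3) = 1" "f0 (parallel 1 3) = 0"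
      using f0(2) by (simp_all add: serial_def parallel_def)
    with f0(1) have c0: "A = 0"
      unfolding annihilator_def annihilates_def mem_Collect_eq
      by - (elim conjE, simp add: diff_eq_eq)
    show "A = 0"
      using c0 by simp
  next
    fix g :: "tree4 \<Rightarrow> 'f" assume *: "A = 0"
    then show "\<exists>f\<in>annihilator. \<forall>t\<in>?N. f t = g t"
      by (intro bexI[of _ "cubic_function
         [g (serial 1 1), 0, g (serial 1 3), 0,
          0, 0, 0, 0,
          g (serial 3 1), 0, g (serial 3 3), 0,
          0, 0, 0, 0,
          0, g (parallel 1 3), 0, 0, 0, 0]"])
        (simp_all add: quadratic_pair.annihilator_def annihilates_def cubic_function_simps[unfolded One_nat_def])
  qed
  let ?f = "cubic_function
         [1, 0, 0, 0,
          0, 0, 0, 0,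
          0, 0, 0, 0,
          0, 0, 0, 0,
          0, 0, 0, 0, 0, 0]"
  have "?f \<in> annihilator" "?f (serial 1 1) \<noteq> (0 :: 'f)"
    by (simp_all add: quadratic_pair.annihilator_def annihilates_def cubic_function_simps[unfolded One_nat_def])
  moreover have "serial 1 1 \<in> set cubic_trees"
    by (simp add: cubic_trees_def)
  ultimately show "cubic_rank R \<noteq> 22"
    unfolding rank_22_iff by blast
qed

text \<open>Both rules send trees to 0, so the two reductions of an ambiguous tree always agree and
  no constraint arises.\<close>

lemma pivots_34:
  shows "17 \<le> cubic_rank (quadratic_pair.R 0 0 1 0 0 0 0 1 :: 'f::field opd set)"
    and "cubic_rank (quadratic_pair.R 0 0 1 0 0 0 0 1 :: 'f::field opd set) = 17"
    and "cubic_rank (quadratic_pair.R 0 0 1 0 0 0 0 1 :: 'f::field opd set) \<noteq> 22"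
proof -
  interpret quadratic_pair 0 0 1 0 0 0 0 "1 :: 'f" .
  let ?N = "{serial 1 1, serial 1 2, serial 2 1, serial 2 2, parallel 1 2}"
  have N: "?N \<subseteq> set cubic_trees" "card ?N = 5"
    by (simp_all add: cubic_trees_def) (simp add: serial_def parallel_def)
  have normal: "\<forall>f\<in>annihilator. (\<forall>t\<in>?N. f t = 0) \<longrightarrow> (\<forall>t\<in>set cubic_trees. f t = 0)"
    by (simp add: annihilator_def annihilates_def cubic_trees_def diff_eq_eq)
  show "17 \<le> cubic_rank R"
    by (rule rank_17(1)[OF N normal])
  show "cubic_rank R = 17"
    unfolding rank_17(2)[OF N normal]
  proof
    fix g :: "tree4 \<Rightarrow> 'f"
    show "\<exists>f\<in>annihilator. \<forall>t\<in>?N. f t = g t"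
      by (intro bexI[of _ "cubic_function
         [g (serial 1 1), g (serial 1 2), 0, 0,
          g (serial 2 1), g (serial 2 2), 0, 0,
          0, 0, 0, 0,
          0, 0, 0, 0,
          g (parallel 1 2), 0, 0, 0, 0, 0]"])
        (simp_all add: quadratic_pair.annihilator_def annihilates_def cubic_function_simps[unfolded One_nat_def])
  qed
  let ?f = "cubic_function
         [1, 0, 0, 0,
          0, 0, 0, 0,
          0, 0, 0, 0,
          0, 0, 0, 0,
          0, 0, 0, 0, 0, 0]"
  have "?f \<in> annihilator" "?f (serial 1 1) \<noteq> (0 :: 'f)"
    by (simp_all add: quadratic_pair.annihilator_def annihilates_def cubic_function_simps[unfolded One_nat_def])
  moreover have "serial 1 1 \<in> set cubic_trees"
    by (simp add: cubic_trees_def)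
  ultimately show "cubic_rank R \<noteq> 22"
    unfolding rank_22_iff by blast
qed

section \<open>Generic parameters\<close>

text \<open>
  Each row is the difference of the two reductions of an ambiguous tree (\<open>serial 1 1\<close>,
  \<open>serial 1 2\<close>, \<open>serial 2 1\<close>, \<open>serial 2 2\<close>, \<open>parallel 1 2\<close>), expressed in the five
  irreducible trees.
\<close>

definition syzygy_matrix :: "'a::comm_ring_1 \<Rightarrow> 'a \<Rightarrow> 'a \<Rightarrow> 'a \<Rightarrow> 'a mat" where
  "syzygy_matrix A B C D = mat 5 5 (\<lambda>(i, j).
    [[A*A*A + A*B*C, A*A*B + A*B*D - A*A, A*B*B - A*B, B*B*B - B*B, 0],
     [A*A*C + A*C*D, A*B*C + A*D*D - A*C, A*B*D - A*D, B*B*D - B*D, 0],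
     [A*C*C + B*C, A*C*D - C*C, A*A*D + B*C*D - C*D, A*B*D + B*D*D - D*D, - (C*D)],
     [C*C*C + C*D - A*C, C*C*D - B*C, A*C*D + C*D*D, B*C*D + D*D*D, - D],
     [A, - (A*C), 0, 0, - (A*D)]] ! i ! j)"

lemma lessThan_5: "{0..<5::nat} = {0, 1, 2, 3, 4}"
  by auto

lemma less_5: "i < 5 \<longleftrightarrow> i = 0 \<or> i = 1 \<or> i = 2 \<or> i = 3 \<or> i = 4" for i :: nat
  by arith

text \<open>The left-hand sides have exactly the unsimplified shape that \<open>annihilates\<close>
  takes for the two rows, so unfolding turns each conjunct into a literal rewrite rule.\<close>

lemma solve_first: "1 * x + 0 * y + - a * z + - b * w = 0 \<longleftrightarrow> x = a * z + b * w"
  and solve_second: "0 * x + 1 * y + - a * z + - b * w = 0 \<longleftrightarrow> y = a * z + b * w"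
  for x :: "'a::comm_ring_1"
  by (auto simp: algebra_simps)

lemma annihilator_12_syzygies:
  assumes "f \<in> quadratic_pair.annihilator 1 0 (-A) (-B) 0 1 (-C) (-D)"
  shows "syzygy_matrix A B C D *\<^sub>v
    vec_of_list [f (serial 3 3), f (serial 3 4), f (serial 4 3), f (serial 4 4), f (parallel 3 4)] = 0\<^sub>v 5"
proof -
  \<comment> \<open>The facts \<open>e\<close> are the two reductions of each of the five ambiguous
    trees; \<open>r\<close> gives the only reduction of each of the twelve trees with one pivot
    edge. Substituting \<open>r\<close> into the differences leaves irreducible trees only.\<close>
  have e:
    "f (serial 1 1) = A * f (serial 1 3) + B * f (serial 1 4)"
    "f (serial 2 1) = A * f (serial 2 3) + B * f (serial 2 4)"
    "f (serial 1 1) = A * f (parallel 1 3) + B * f (parallel 1 4)"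
    "f (serial 1 2) = A * f (parallel 2 3) + B * f (parallel 2 4)"
    "f (serial 1 2) = C * f (serial 1 3) + D * f (serial 1 4)"
    "f (serial 2 2) = C * f (serial 2 3) + D * f (serial 2 4)"
    "f (serial 2 1) = C * f (parallel 2 3) + D * f (parallel 2 4)"
    "f (serial 2 2) = C * f (serial 3 1) + D * f (parallel 3 4)"
    "f (parallel 1 2) = A * f (serial 3 3) + B * f (serial 4 2)"
    "f (parallel 1 2) = C * f (parallel 1 3) + D * f (parallel 1 4)"
    and r:
    "f (serial 1 3) = A * f (serial 3 1) + B * f (parallel 3 4)"
    "f (serial 1 4) = A * f (serial 3 2) + B * f (serial 4 1)"
    "f (serial 2 3) = C * f (serial 3 2) + D * f (serial 4 1)"
    "f (serial 2 4) = C * f (serial 3 3) + D * f (serial 4 2)"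
    "f (parallel 1 3) = A * f (serial 3 4) + B * f (serial 4 3)"
    "f (parallel 2 3) = C * f (serial 3 4) + D * f (serial 4 3)"
    "f (parallel 1 4) = A * f (parallel 3 4) + B * f (serial 4 4)"
    "f (parallel 2 4) = C * f (parallel 3 4) + D * f (serial 4 4)"
    "f (serial 3 1) = A * f (serial 3 3) + B * f (serial 3 4)"
    "f (serial 3 2) = C * f (serial 3 3) + D * f (serial 3 4)"
    "f (serial 4 1) = A * f (serial 4 3) + B * f (serial 4 4)"
    "f (serial 4 2) = C * f (serial 4 3) + D * f (serial 4 4)"
    using assms
    unfolding quadratic_pair.annihilator_def annihilates_def mem_Collect_eq solve_first solve_second
    by - ((elim conjE, assumption)+)
  have "A * f (serial 1 3) + B * f (serial 1 4) - (A * f (parallel 1 3) + B * f (parallel 1 4)) = 0"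
    "C * f (serial 1 3) + D * f (serial 1 4) - (A * f (parallel 2 3) + B * f (parallel 2 4)) = 0"
    "A * f (serial 2 3) + B * f (serial 2 4) - (C * f (parallel 2 3) + D * f (parallel 2 4)) = 0"
    "C * f (serial 2 3) + D * f (serial 2 4) - (C * f (serial 3 1) + D * f (parallel 3 4)) = 0"
    "A * f (serial 3 3) + B * f (serial 4 2) - (C * f (parallel 1 3) + D * f (parallel 1 4)) = 0"
    using e by simp_all
  then show ?thesis
    unfolding r
    by (intro eq_vecI)
      (auto simp: syzygy_matrix_def less_5 scalar_prod_def lessThan_5 algebra_simps)
qed

lemma pivots_12_rank_22:
  fixes A B C D :: "'f::field"
  assumes "det (syzygy_matrix A B C D) \<noteq> 0"
  shows "cubic_rank (quadratic_pair.R 1 0 (- A) (- B) 0 1 (- C) (- D)) = 22"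
proof -
  interpret quadratic_pair 1 0 "-A" "-B" 0 1 "-C" "-D" .
  have "\<forall>t\<in>set cubic_trees. f t = 0" if f: "f \<in> annihilator" for f
  proof -
    let ?v = "vec_of_list [f (serial 3 3), f (serial 3 4), f (serial 4 3), f (serial 4 4), f (parallel 3 4)]"
    have "?v = 0\<^sub>v 5"
    proof (rule ccontr)
      assume "?v \<noteq> 0\<^sub>v 5"
      moreover have "?v \<in> carrier_vec 5" by (rule carrier_vecI) simp
      moreover have "syzygy_matrix A B C D \<in> carrier_mat 5 5" by (simp add: syzygy_matrix_def)
      ultimately show False
        using annihilator_12_syzygies[OF f] assms det_0_iff_vec_prod_zero_field[of "syzygy_matrix A B C D" 5] by metis
    qed
    then have "[f (serial 3 3), f (serial 3 4), f (serial 4 3), f (serial 4 4), f (parallel 3 4)] ! i = 0"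
      if "i < 5" for i using that by (metis index_zero_vec(1) vec_of_list_index)
    from this[of 0] this[of 1] this[of 2] this[of 3] this[of 4] show ?thesis
      using f by (simp add: annihilator_def annihilates_def cubic_trees_def diff_eq_eq)
  qed
  then show ?thesis unfolding rank_22_iff by blast
qed

text \<open>At this point the matrix is so sparse that the equations of its kernel form one cycle.
  Following it around makes the last coordinate equal to both the first one and its negative, so
  characteristic 0 makes all coordinates vanish.\<close>

lemma det_syzygy_matrix_nonzero:
  "det (syzygy_matrix 1 0 0 (- 1) :: 'f::field_char_0 mat) \<noteq> 0"
proof
  let ?S = "syzygy_matrix 1 0 0 (- 1) :: 'f mat"
  assume "det ?S = 0"
  then obtain v where v: "v \<in> carrier_vec 5" "v \<noteq> 0\<^sub>v 5" "?S *\<^sub>v v = 0\<^sub>v 5"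
    using det_0_iff_vec_prod_zero_field[of ?S 5] by (auto simp: syzygy_matrix_def)
  then have "(?S *\<^sub>v v) $ i = 0" if "i < 5" for i using that by simp
  from this[of 0] this[of 1] this[of 2] this[of 3] this[of 4]
  have "v $ 0 = v $ 1" "v $ 2 = - v $ 1" "v $ 3 = - v $ 2" "v $ 4 = v $ 3" "v $ 4 = - v $ 0"
    using v(1) by (simp_all add: syzygy_matrix_def scalar_prod_def lessThan_5 eq_neg_iff_add_eq_0 add.commute)
  then have "v $ i = 0" if "i < 5" for i
    using that by (auto simp: less_5)
  then show False using v(1,2) by auto
qed

text \<open>Evaluation is a ring homomorphism and commutes with the determinant. With polynomial
  entries, \<open>syzygy_matrix\<close> thus describes the determinant along a whole line of
  parameters as one univariate polynomial.\<close>

lemma poly_det_syzygy_matrix: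
  fixes A B C D :: "'f::field poly"
  shows "poly (det (syzygy_matrix A B C D)) t =
    det (syzygy_matrix (poly A t) (poly B t) (poly C t) (poly D t))"
proof -
  interpret comm_ring_hom "\<lambda>p. poly p t" by unfold_locales auto
  have "map_mat (\<lambda>p. poly p t) (syzygy_matrix A B C D) =
      syzygy_matrix (poly A t) (poly B t) (poly C t) (poly D t)"
    by (rule eq_matI) (auto simp: syzygy_matrix_def less_5)
  then show ?thesis by (metis hom_det)
qed

section \<open>Zariski density along lines\<close>

definition line_point :: "'f::field vec \<Rightarrow> 'f vec \<Rightarrow> 'f \<Rightarrow> 'f vec" where
  "line_point x y t = vec (dim_vec x) (\<lambda>i. x $ i + t * (y $ i - x $ i))"

lemma mpoly_eval_line:
  assumes "p \<in> mpolys n" "x \<in> carrier_vec n"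
  obtains P where "\<And>t. poly P t = mpoly_eval p (line_point x y t)"
proof -
  let ?P = "\<Sum>m\<in>Poly_Mapping.keys p. Polynomial.smult (Poly_Mapping.lookup p m)
      (\<Prod>i\<in>Poly_Mapping.keys m. [:x $ i, y $ i - x $ i:] ^ Poly_Mapping.lookup m i)"
  have "i < n" if "m \<in> Poly_Mapping.keys p" "i \<in> Poly_Mapping.keys m" for m i
    using assms(1) that by (auto simp: mpolys_def)
  then have coord: "poly [:x $ i, y $ i - x $ i:] t = line_point x y t $ i"
    if "m \<in> Poly_Mapping.keys p" "i \<in> Poly_Mapping.keys m" for m i t
    using assms(2) that by (simp add: line_point_def)
  have "poly ?P t = mpoly_eval p (line_point x y t)" for t
    unfolding mpoly_eval_def poly_sum poly_smult poly_prod poly_power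
    by (intro sum.cong refl arg_cong2[where f = "(*)"] prod.cong arg_cong2[where f = "power"] coord)
  then show thesis by (rule that)
qed

text \<open>Density is tested on the lines through a fixed point \<open>y\<close>: a polynomial that vanishes at all
  but finitely many points of such a line vanishes on the whole line.\<close>

lemma zariski_dense_by_lines:
  fixes S :: "'f::field_char_0 vec set"
  assumes S: "S \<subseteq> carrier_vec n"
    and line: "\<And>x. x \<in> carrier_vec n \<Longrightarrow> \<exists>F. F \<noteq> 0 \<and> (\<forall>t. poly F t \<noteq> 0 \<longrightarrow> line_point x y t \<in> S)"
  shows "zariski_dense n S"
  unfolding zariski_dense_def
proof (intro conjI S equalityI subsetI)
  have "zariski_closed n (carrier_vec n)"
    unfolding zariski_closed_def by (rule exI[of _ "{}"]) auto
  then show "x \<in> carrier_vec n" if "x \<in> \<Inter> {Z. zariski_closed n Z \<and> S \<subseteq> Z}" for x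
    using that S by blast
  fix x :: "'f vec" assume x: "x \<in> carrier_vec n"
  show "x \<in> \<Inter> {Z. zariski_closed n Z \<and> S \<subseteq> Z}"
  proof safe
    fix Z assume "zariski_closed n Z" "S \<subseteq> Z"
    then obtain P where P: "P \<subseteq> mpolys n" "Z = {x \<in> carrier_vec n. \<forall>p\<in>P. mpoly_eval p x = 0}"
      unfolding zariski_closed_def by blast
    have "mpoly_eval p x = 0" if "p \<in> P" for p
    proof -
      obtain F where F: "F \<noteq> 0" "\<And>t. poly F t \<noteq> 0 \<Longrightarrow> line_point x y t \<in> S"
        using line[OF x] by blast
      obtain Q where Q: "\<And>t. poly Q t = mpoly_eval p (line_point x y t)"
        using mpoly_eval_line[of p n x] P(1) \<open>p \<in> P\<close> x by blast
      \<comment> \<open>Where \<open>F\<close> does not vanish the point is in \<open>S\<close>, so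
        \<open>Q\<close> does. The product vanishes identically, hence is the zero polynomial over
        an infinite field, and no zeros have to be counted.\<close>
      have "poly (Q * F) t = 0" for t
        using F(2)[of t] Q[of t] \<open>S \<subseteq> Z\<close> P(2) \<open>p \<in> P\<close> by auto
      then have "Q = 0" using F(1) by (metis mult_eq_0_iff poly_all_0_iff_0)
      moreover have "line_point x y 0 = x" by (auto simp: line_point_def)
      ultimately show ?thesis using Q[of 0] by simp
    qed
    then show "x \<in> Z" using x P(2) by simp
  qed
qed

section \<open>Row canonical forms\<close>

lemma quadratic_lookup:
  "Poly_Mapping.lookup (quadratic a b c d) t =
    (if t = graft corolla 1 corolla then a else if t = graft corolla 2 corolla then b
     else if t = graft corolla 3 corolla then c else if t = graft corolla 4 corolla then d else 0)"
  by (simp add: quadratic_def circ_phi_phi lookup_add lookup_scale lookup_monomial)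

lemma quadratic_eq_iff:
  "quadratic a b c d = quadratic a' b' c' d' \<longleftrightarrow> a = a' \<and> b = b' \<and> c = c' \<and> d = d'"
proof
  assume eq: "quadratic a b c d = quadratic a' b' c' d'"
  have "Poly_Mapping.lookup (quadratic a b c d) (graft corolla j corolla) =
      Poly_Mapping.lookup (quadratic a' b' c' d') (graft corolla j corolla)" for j
    by (simp only: eq)
  from this[of 1] this[of 2] this[of 3] this[of 4]
  show "a = a' \<and> b = b' \<and> c = c' \<and> d = d'"
    unfolding quadratic_lookup by simp
qed simp

lemma quadratic_zero: "quadratic 0 0 0 0 = 0"
  by (simp add: quadratic_def)

lemma quadratic_scale: "scale k (quadratic a b c d) = quadratic (k * a) (k * b) (k * c) (k * d)"
  by (simp add: quadratic_def opd.scale_right_distrib)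

lemma quadratic_diff:
  "quadratic a b c d - quadratic a' b' c' d' = quadratic (a - a') (b - b') (c - c') (d - d')"
  by (simp add: quadratic_def opd.scale_left_diff_distrib)

lemma component_7_quadratic:
  assumes "p \<in> component 7"
  obtains a b c d where "p = quadratic a b c d"
proof -
  have "leaves t \<noteq> 7 \<or> t = graft corolla 1 corolla \<or> t = graft corolla 2 corolla
     \<or> t = graft corolla 3 corolla \<or> t = graft corolla 4 corolla" for t
    using nodes_2[of t] by (auto simp: leaves_eq)
  with assms have "p = quadratic (Poly_Mapping.lookup p (graft corolla 1 corolla))
    (Poly_Mapping.lookup p (graft corolla 2 corolla))
    (Poly_Mapping.lookup p (graft corolla 3 corolla))
    (Poly_Mapping.lookup p (graft corolla 4 corolla))"
    unfolding component_iff by (intro poly_mapping_eqI) (auto simp: quadratic_lookup)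
  then show thesis by (rule that)
qed

text \<open>Cramer's rule: the new vectors arise from \<open>u\<close> and \<open>v\<close> by the
  inverse of the matrix with rows \<open>p q\<close> and \<open>r s\<close>. If these are the
  entries of \<open>u\<close> and \<open>v\<close> in two columns, the new pair has the identity
  matrix there.\<close>

lemma (in vector_space) span_pair_change_basis:
  assumes "p * s - q * r \<noteq> 0"
  shows "span {u, v} = span {scale (1 / (p * s - q * r)) (scale s u - scale q v),
    scale (1 / (p * s - q * r)) (scale p v - scale r u)}"
proof -
  let ?m = "p * s - q * r"
  define x y where "x = scale (1 / ?m) (scale s u - scale q v)"
    and "y = scale (1 / ?m) (scale p v - scale r u)"
  have "scale p (scale s u - scale q v) + scale q (scale p v - scale r u) = scale ?m u"
    "scale r (scale s u - scale q v) + scale s (scale p v - scale r u) = scale ?m v"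
    by (simp_all add: scale_left_diff_distrib scale_right_diff_distrib mult.commute)
  moreover have "scale k x + scale l y =
      scale (1 / ?m) (scale k (scale s u - scale q v) + scale l (scale p v - scale r u))" for k l
    by (simp add: x_def y_def scale_right_distrib)
  ultimately have uv: "u = scale p x + scale q y" "v = scale r x + scale s y"
    using assms by simp_all
  have "scale k x + scale l y \<in> span {x, y}" for k l
    by (intro span_add span_scale span_base) auto
  moreover have "x \<in> span {u, v}" "y \<in> span {u, v}"
    unfolding x_def y_def by (intro span_scale span_diff span_base; simp)+
  ultimately have "{u, v} \<subseteq> span {x, y}" "{x, y} \<subseteq> span {u, v}"
    using uv by simp_all
  then show ?thesis unfolding span_eq x_def[symmetric] y_def[symmetric] by (rule conjI)
qed

text \<open>The pivots are the columns of the lexicographically first nonzero 2 by 2 minor of a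
  basis. After the change of basis the remaining entries are quotients of minors, and the earlier
  minors being 0 produces the zeros to the left of the pivots.\<close>

lemma quadratic_relations_cases:
  fixes R :: "'f::field opd set"
  assumes "quadratic_relations 2 R"
  obtains
    (columns_12) A B C D where "R = quadratic_pair.R 1 0 (- A) (- B) 0 1 (- C) (- D)"
  | (columns_13) A B C where "R = quadratic_pair.R 1 (- A) 0 (- B) 0 0 1 (- C)"
  | (columns_14) A B where "R = quadratic_pair.R 1 (- A) (- B) 0 0 0 0 1"
  | (columns_23) A B where "R = quadratic_pair.R 0 1 0 (- A) 0 0 1 (- B)"
  | (columns_24) A where "R = quadratic_pair.R 0 1 (- A) 0 0 0 0 1"
  | (columns_34) "R = quadratic_pair.R 0 0 1 0 0 0 0 1"
proof -
  have R: "opd.subspace R" "R \<subseteq> component 7" "opd.dim R = 2"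
    using assms by (auto simp: quadratic_relations_def)
  obtain \<B> where \<B>: "\<B> \<subseteq> R" "opd.independent \<B>" "R \<subseteq> opd.span \<B>" "card \<B> = 2"
    using opd.basis_exists[of R] R(3) by metis
  then obtain u v where uv: "\<B> = {u, v}" "u \<noteq> v" by (meson card_2_iff)
  have span: "R = opd.span {u, v}"
    using \<B> R(1) uv(1) opd.span_minimal by blast
  have "u \<in> component 7" using \<B>(1) R(2) uv(1) by blast
  then obtain u1 u2 u3 u4 where u: "u = quadratic u1 u2 u3 u4"
    by (rule component_7_quadratic)
  have "v \<in> component 7" using \<B>(1) R(2) uv(1) by blast
  then obtain v1 v2 v3 v4 where v: "v = quadratic v1 v2 v3 v4"
    by (rule component_7_quadratic)
  have change: "R = quadratic_pair.R
      ((s * u1 - q * v1) / (p * s - q * r)) ((s * u2 - q * v2) / (p * s - q * r))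
      ((s * u3 - q * v3) / (p * s - q * r)) ((s * u4 - q * v4) / (p * s - q * r))
      ((p * v1 - r * u1) / (p * s - q * r)) ((p * v2 - r * u2) / (p * s - q * r))
      ((p * v3 - r * u3) / (p * s - q * r)) ((p * v4 - r * u4) / (p * s - q * r))"
    if "p * s - q * r \<noteq> 0" for p q r s
    unfolding span opd.span_pair_change_basis[OF that, of u v] quadratic_pair.R_def
    by (simp add: u v quadratic_scale quadratic_diff)
  have indep: "v \<notin> opd.span {u}" "u \<noteq> 0"
    using \<B>(2) uv opd.dependent_zero[of "{u, v}"]
    by (auto simp: opd.independent_insert insert_commute[of u v] split: if_splits)
  show thesis
  proof (cases "u1 * v2 - u2 * v1 = 0")
    case False
    from change[OF this] show thesis
      using columns_12[of "- x" "- y" "- z" "- w" for x y z w] False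
      by (simp add: mult.commute)
  next
    case m12: True
    show thesis
    proof (cases "u1 * v3 - u3 * v1 = 0")
      case False
      from change[OF this] show thesis
        using columns_13[of "- x" "- y" "- z" for x y z] False m12
        by (simp add: mult.commute)
    next
      case m13: True
      show thesis
      proof (cases "u1 * v4 - u4 * v1 = 0")
        case False
        from change[OF this] show thesis
          using columns_14[of "- x" "- y" for x y] False m12 m13
          by (simp add: mult.commute)
      next
        case m14: True
        show thesis
        proof (cases "u2 * v3 - u3 * v2 = 0")
          case False
          from change[OF this] show thesis
            using columns_23[of "- x" "- y" for x y] False m12 m13 m14
            by (simp add: mult.commute)
        next
          case m23: True
          show thesis
          proof (cases "u2 * v4 - u4 * v2 = 0")
            case False
            from change[OF this] show thesis
              using columns_24[of "- x" for x] False m12 m13 m14 m23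
              by (simp add: mult.commute)
          next
            case m24: True
            show thesis
            proof (cases "u3 * v4 - u4 * v3 = 0")
              case False
              from change[OF this] show thesis
                using columns_34 False m12 m13 m14 m23 m24
                by (simp add: mult.commute)
            next
              case m34: True
              note minors = m12 m13 m14 m23 m24 m34
              \<comment> \<open>If all six minors vanish, \<open>v\<close> is a multiple of
                \<open>u\<close>; the factor is read off at any nonzero coordinate of
                \<open>u\<close>.\<close>
              have "u1 \<noteq> 0 \<or> u2 \<noteq> 0 \<or> u3 \<noteq> 0 \<or> u4 \<noteq> 0"
                using indep(2) u quadratic_zero by auto
              then have "v = scale (v1 / u1) u \<or> v = scale (v2 / u2) u \<or>
                  v = scale (v3 / u3) u \<or> v = scale (v4 / u4) u"
                using minors by (auto simp: u v quadratic_scale quadratic_eq_iff field_simps)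
              then have "v \<in> opd.span {u}"
                using opd.span_scale[OF opd.span_base[of u "{u}"]] by auto
              then show thesis using indep(1) by simp
            qed
          qed
        qed
      qed
    qed
  qed
qed

lemma (in quadratic_pair) relations_quadratic:
  assumes "opd.dim R = 2"
  shows "quadratic_relations 2 R"
  using assms subspace_R R_subset by (simp add: quadratic_relations_def)

lemma dim_relations_12: "opd.dim (quadratic_pair.R 1 0 a b 0 1 c d) = 2"
proof -
  have "opd.independent {quadratic 1 0 a b, quadratic 0 1 c d}"
    unfolding opd.independent_insert
    by (auto simp: opd.span_singleton quadratic_scale quadratic_eq_iff opd.independent_empty simp flip: quadratic_zero)
  then have "opd.dim (quadratic_pair.R 1 0 a b 0 1 c d) = card {quadratic 1 0 a b, quadratic 0 1 c d}"
    unfolding quadratic_pair.R_def by (rule opd.dim_span_eq_card_independent)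
  then show ?thesis by (simp add: quadratic_eq_iff)
qed

lemma quadratic_row_space_two_rows:
  assumes "A \<in> carrier_mat 2 4"
  shows "quadratic_row_space A = quadratic_pair.R
    (A $$ (0, 0)) (A $$ (0, 1)) (A $$ (0, 2)) (A $$ (0, 3))
    (A $$ (1, 0)) (A $$ (1, 1)) (A $$ (1, 2)) (A $$ (1, 3))"
proof -
  have "{..<dim_row A} = {0, 1}" "{..<4::nat} = {0, 1, 2, 3}" using assms by auto
  then show ?thesis
    by (simp add: quadratic_row_space_def quadratic_pair.R_def quadratic_def add.assoc eval_nat_numeral)
qed

lemma row_canonical_form_12:
  defines "M \<equiv> \<lambda>a b c d. mat_of_rows_list 4 [[1, 0, a, b], [0, 1, c, d]]"
  shows "row_canonical_form (quadratic_pair.R 1 0 a b 0 1 c d) (M a b c d)"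
proof -
  have carrier: "M a b c d \<in> carrier_mat 2 4" by (simp add: M_def mat_of_rows_list_def numeral_2_eq_2)
  have "pivot_fun (M a b c d) (\<lambda>i. i) 4"
    by (rule pivot_funI[where nr = 2]) (auto simp: M_def mat_of_rows_list_def less_2_cases_iff)
  then have "row_echelon_form (M a b c d)"
    using carrier by (auto simp: row_echelon_form_def)
  moreover have "quadratic_row_space (M a b c d) = quadratic_pair.R 1 0 a b 0 1 c d"
    unfolding quadratic_row_space_two_rows[OF carrier] by (simp add: M_def mat_of_rows_list_def)
  ultimately show ?thesis
    using carrier by (simp add: row_canonical_form_def dim_relations_12)
qed

section \<open>Parameters of rank 22 and the classification of rank 17\<close>

lemma rank_22_dense:
  defines "M \<equiv> \<lambda>a b c d. mat_of_rows_list 4 [[1, 0, a, b], [0, 1, c, d]]"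
  shows "zariski_dense 4 {vec_of_list [a, b, c, d] | a b c d.
    \<exists>R. quadratic_relations 2 R \<and> row_canonical_form R (M a b c d) \<and>
      cubic_rank (R :: 'f::field_char_0 opd set) = 22}"
    (is "zariski_dense 4 ?S")
proof (rule zariski_dense_by_lines)
  \<comment> \<open>This is the point of \<open>det_syzygy_matrix_nonzero\<close> with all signs
    changed, because \<open>syzygy_matrix\<close> takes the negated entries of the row canonical
    form; \<open>coord\<close> carries the same sign. Each line reaches \<open>?y\<close> at
    parameter value 1, so \<open>?F\<close> is nonzero on every line.\<close>
  let ?y = "vec_of_list [- 1, 0, 0, 1] :: 'f vec"
  show "?S \<subseteq> carrier_vec 4"
    by (auto intro!: carrier_vecI)
  fix x :: "'f vec" assume x: "x \<in> carrier_vec 4"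
  define coord where "coord i = - [:x $ i, ?y $ i - x $ i:]" for i
  let ?F = "det (syzygy_matrix (coord 0) (coord 1) (coord 2) (coord 3))"
  have coord: "poly (coord i) t = - (line_point x ?y t $ i)" if "i < 4" for i t
    using x that by (simp add: coord_def line_point_def algebra_simps del: vec_of_list_Cons)
  have "poly ?F 1 \<noteq> 0"
  proof -
    have "?y $ 0 = - 1" "?y $ 1 = 0" "?y $ 2 = 0" "?y $ 3 = 1"
      by (simp_all add: vec_of_list_index del: vec_of_list_Cons)
    then show ?thesis
      unfolding poly_det_syzygy_matrix using det_syzygy_matrix_nonzero
      by (simp add: coord_def)
  qed
  then have "?F \<noteq> 0" by auto
  moreover have "line_point x ?y t \<in> ?S" if "poly ?F t \<noteq> 0" for t
  proof -
    let ?z = "line_point x ?y t"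
    let ?R = "quadratic_pair.R 1 0 (?z $ 0) (?z $ 1) 0 1 (?z $ 2) (?z $ 3)"
    have "cubic_rank ?R = 22"
      using that pivots_12_rank_22[of "- ?z $ 0" "- ?z $ 1" "- ?z $ 2" "- ?z $ 3"]
      unfolding poly_det_syzygy_matrix by (simp add: coord)
    moreover have "quadratic_relations 2 ?R"
      by (rule quadratic_pair.relations_quadratic[OF dim_relations_12])
    moreover have "?z = vec_of_list [?z $ 0, ?z $ 1, ?z $ 2, ?z $ 3]"
    proof (rule eq_vecI)
      show "dim_vec ?z = dim_vec (vec_of_list [?z $ 0, ?z $ 1, ?z $ 2, ?z $ 3])"
        using x by (simp add: line_point_def)
      fix i assume "i < dim_vec (vec_of_list [?z $ 0, ?z $ 1, ?z $ 2, ?z $ 3])"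
      then have "i = 0 \<or> i = 1 \<or> i = 2 \<or> i = 3" by auto
      then show "?z $ i = vec_of_list [?z $ 0, ?z $ 1, ?z $ 2, ?z $ 3] $ i"
        unfolding vec_of_list_index by auto
    qed
    ultimately show ?thesis
      using row_canonical_form_12 unfolding M_def by blast
  qed
  ultimately show "\<exists>F. F \<noteq> 0 \<and> (\<forall>t. poly F t \<noteq> 0 \<longrightarrow> line_point x ?y t \<in> ?S)"
    by blast
qed

lemma rank_22_only_pivots_12:
  fixes R :: "'f::field opd set"
  assumes R: "quadratic_relations 2 R" "row_canonical_form R A"
    and f: "pivot_fun A f 4" "{f 0, f 1} \<noteq> {0, 1}"
  shows "cubic_rank R \<noteq> 22"
proof -
  have dim: "opd.dim R = 2" and A: "A \<in> carrier_mat 2 4" and row: "R = quadratic_row_space A"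
    using R by (auto simp: quadratic_relations_def row_canonical_form_def)
  have nr: "dim_row A = 2" using A by simp
  note pivot = pivot_funD[OF nr f(1)]
  note R_eq = row[unfolded quadratic_row_space_two_rows[OF A]]
  \<comment> \<open>A pivot function marks a zero row by the number of columns, here 4. A zero
    second row would leave at most one dimension for \<open>R\<close>.\<close>
  have "f 1 \<noteq> 4"
  proof
    assume "f 1 = 4"
    then have "A $$ (1, j) = 0" if "j < 4" for j using pivot(2)[of 1 j] that by simp
    then have "R \<subseteq> opd.span {quadratic (A $$ (0, 0)) (A $$ (0, 1)) (A $$ (0, 2)) (A $$ (0, 3))}"
      unfolding R_eq quadratic_pair.R_def
      by (intro opd.span_minimal) (auto simp: quadratic_zero opd.span_zero intro: opd.span_base)
    then have "opd.dim R \<le> card {quadratic (A $$ (0, 0)) (A $$ (0, 1)) (A $$ (0, 2)) (A $$ (0, 3))}"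
      by (rule opd.dim_le_card) simp
    then show False using dim by simp
  qed
  then have lt: "f 0 < f 1" "f 1 < 4"
    using pivot(1)[of 1] pivot(3)[of 0] by auto
  have one: "A $$ (0, f 0) = 1" "A $$ (1, f 0) = 0" "A $$ (1, f 1) = 1" "A $$ (0, f 1) = 0"
    using pivot(4)[of 0] pivot(4)[of 1] pivot(5)[of 0 1] pivot(5)[of 1 0] lt by auto
  have zero: "\<forall>j<f 0. A $$ (0, j) = 0" "\<forall>j<f 1. A $$ (1, j) = 0 \<or> j = f 1"
    using pivot(2) by auto
  consider "f 0 = 0" "f 1 = 2" | "f 0 = 0" "f 1 = 3" | "f 0 = 1" "f 1 = 2" | "f 0 = 1" "f 1 = 3"
    | "f 0 = 2" "f 1 = 3"
  proof -
    have "f 1 = 1 \<or> f 1 = 2 \<or> f 1 = 3" using lt by arith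
    then show thesis using that lt(1) f(2) by (auto simp: less_Suc_eq numeral_eq_Suc)
  qed
  then show ?thesis
  proof cases
    case 1
    then show ?thesis
      using one zero pivots_13(3)[of "- A $$ (0, 1)" "- A $$ (0, 3)" "- A $$ (1, 3)"]
      by (simp add: R_eq)
  next
    case 2
    then show ?thesis
      using one zero pivots_14(3)[of "- A $$ (0, 1)" "- A $$ (0, 2)"] by (simp add: R_eq)
  next
    case 3
    then show ?thesis
      using one zero pivots_23(3)[of "- A $$ (0, 3)" "- A $$ (1, 3)"] by (simp add: R_eq)
  next
    case 4
    then show ?thesis
      using one zero pivots_24(3)[of "- A $$ (0, 2)"] by (simp add: R_eq)
  next
    case 5
    then show ?thesis
      using one zero pivots_34(3) by (simp add: R_eq)
  qed
qed

lemma rank_ge_17: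
  assumes "quadratic_relations 2 R"
  shows "17 \<le> cubic_rank R"
  using assms by (cases rule: quadratic_relations_cases)
    (auto intro: pivots_12(1) pivots_13(1) pivots_14(1) pivots_23(1) pivots_24(1) pivots_34(1))

lemma rank_17_iff:
  fixes R :: "'f::field opd set"
  defines "q \<equiv> \<lambda>i. circ phi i phi :: 'f opd"
  assumes "quadratic_relations 2 R"
  shows "cubic_rank R = 17 \<longleftrightarrow>
    (\<exists>(\<rho>\<^sub>1, \<rho>\<^sub>2) \<in> {(q 1, q 2), (q 1 - q 4, q 2), (q 1, q 3), (q 1 - q 4, q 3),
        (q 1, q 4), (q 2, q 3), (q 2, q 4), (q 3, q 4)}. R = opd.span {\<rho>\<^sub>1, \<rho>\<^sub>2})"
    (is "_ \<longleftrightarrow> ?list")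
proof -
  have q: "q 1 = quadratic 1 0 0 0" "q 1 - q 4 = quadratic 1 0 0 (- 1)"
    "q 2 = quadratic 0 1 0 0" "q 3 = quadratic 0 0 1 0" "q 4 = quadratic 0 0 0 1"
    by (simp_all add: q_def quadratic_def)
  have list: "?list \<longleftrightarrow>
      R = quadratic_pair.R 1 0 0 0 0 1 0 0 \<or> R = quadratic_pair.R 1 0 0 (- 1) 0 1 0 0 \<or>
      R = quadratic_pair.R 1 0 0 0 0 0 1 0 \<or> R = quadratic_pair.R 1 0 0 (- 1) 0 0 1 0 \<or>
      R = quadratic_pair.R 1 0 0 0 0 0 0 1 \<or> R = quadratic_pair.R 0 1 0 0 0 0 1 0 \<or>
      R = quadratic_pair.R 0 1 0 0 0 0 0 1 \<or> R = quadratic_pair.R 0 0 1 0 0 0 0 1"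
    unfolding quadratic_pair.R_def q by (simp add: quadratic_diff)
  have rank:
    "cubic_rank (quadratic_pair.R 1 0 0 0 0 1 0 0 :: 'f opd set) = 17"
    "cubic_rank (quadratic_pair.R 1 0 0 (- 1) 0 1 0 0 :: 'f opd set) = 17"
    "cubic_rank (quadratic_pair.R 1 0 0 0 0 0 1 0 :: 'f opd set) = 17"
    "cubic_rank (quadratic_pair.R 1 0 0 (- 1) 0 0 1 0 :: 'f opd set) = 17"
    "cubic_rank (quadratic_pair.R 1 0 0 0 0 0 0 1 :: 'f opd set) = 17"
    "cubic_rank (quadratic_pair.R 0 1 0 0 0 0 1 0 :: 'f opd set) = 17"
    "cubic_rank (quadratic_pair.R 0 1 0 0 0 0 0 1 :: 'f opd set) = 17"
    "cubic_rank (quadratic_pair.R 0 0 1 0 0 0 0 1 :: 'f opd set) = 17"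
    using pivots_12(2)[of "0 :: 'f" 0 0 0]
      pivots_12(2)[of "0 :: 'f" 1 0 0]
      pivots_13(2)[of "0 :: 'f" 0 0]
      pivots_13(2)[of "0 :: 'f" 1 0]
      pivots_14(2)[of "0 :: 'f" 0]
      pivots_23(2)[of "0 :: 'f" 0]
      pivots_24(2)[of "0 :: 'f"]
      pivots_34(2)[where 'f = 'f]
    by simp_all
  show ?thesis
    unfolding list
  proof
    assume 17: "cubic_rank R = 17"
    from assms(2) show "R = quadratic_pair.R 1 0 0 0 0 1 0 0 \<or> R = quadratic_pair.R 1 0 0 (- 1) 0 1 0 0 \<or>
      R = quadratic_pair.R 1 0 0 0 0 0 1 0 \<or> R = quadratic_pair.R 1 0 0 (- 1) 0 0 1 0 \<or>
      R = quadratic_pair.R 1 0 0 0 0 0 0 1 \<or> R = quadratic_pair.R 0 1 0 0 0 0 1 0 \<or>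
      R = quadratic_pair.R 0 1 0 0 0 0 0 1 \<or> R = quadratic_pair.R 0 0 1 0 0 0 0 1"
    proof (cases rule: quadratic_relations_cases)
      case (columns_12 A B C D)
      then show ?thesis using 17 pivots_12(2)[of A B C D] by auto
    next
      case (columns_13 A B C)
      then show ?thesis using 17 pivots_13(2)[of A B C] by auto
    next
      case (columns_14 A B)
      then show ?thesis using 17 pivots_14(2)[of A B] by auto
    next
      case (columns_23 A B)
      then show ?thesis using 17 pivots_23(2)[of A B] by auto
    next
      case (columns_24 A)
      then show ?thesis using 17 pivots_24(2)[of A] by auto
    next
      case columns_34
      then show ?thesis by blast
    qed
  next
    assume "R = quadratic_pair.R 1 0 0 0 0 1 0 0 \<or> R = quadratic_pair.R 1 0 0 (- 1) 0 1 0 0 \<or>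
      R = quadratic_pair.R 1 0 0 0 0 0 1 0 \<or> R = quadratic_pair.R 1 0 0 (- 1) 0 0 1 0 \<or>
      R = quadratic_pair.R 1 0 0 0 0 0 0 1 \<or> R = quadratic_pair.R 0 1 0 0 0 0 1 0 \<or>
      R = quadratic_pair.R 0 1 0 0 0 0 0 1 \<or> R = quadratic_pair.R 0 0 1 0 0 0 0 1"
    then show "cubic_rank R = 17"
      by (elim disjE) (simp_all only: rank)
  qed
qed

theorem theorem4p15:
  fixes q :: "nat \<Rightarrow> 'f::{alg_closed_field, field_char_0} opd"
    and M :: "'f \<Rightarrow> 'f \<Rightarrow> 'f \<Rightarrow> 'f \<Rightarrow> 'f mat"
  defines "q \<equiv> \<lambda>i. circ phi i phi"
    and "M \<equiv> \<lambda>a b c d. mat_of_rows_list 4 [[1, 0, a, b], [0, 1, c, d]]"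
  shows
    "(\<forall>R :: 'f opd set. quadratic_relations 2 R \<longrightarrow> 17 \<le> cubic_rank R \<and> cubic_rank R \<le> 22) \<and>
     zariski_dense 4 {vec_of_list [a, b, c, d] | a b c d.
        \<exists>R. quadratic_relations 2 R \<and> row_canonical_form R (M a b c d) \<and> cubic_rank R = 22} \<and>
     (\<forall>R a b c d. quadratic_relations 2 R \<and> row_canonical_form R (M a b c d) \<and> cubic_rank R = 22
        \<longrightarrow> quotient_nilpotent (ideal_gen R) 3) \<and>
     (\<forall>(R :: 'f opd set) A f.
        quadratic_relations 2 R \<and> row_canonical_form R A \<and> pivot_fun A f 4 \<and> {f 0, f 1} \<noteq> {0, 1}
        \<longrightarrow> cubic_rank R \<noteq> 22 \<and> \<not> quotient_nilpotent (ideal_gen R) 3) \<and>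
     (\<forall>R :: 'f opd set. quadratic_relations 2 R \<longrightarrow>
        (cubic_rank R = 17 \<longleftrightarrow>
           (\<exists>(\<rho>\<^sub>1, \<rho>\<^sub>2) \<in> {(q 1, q 2), (q 1 - q 4, q 2),
                          (q 1, q 3), (q 1 - q 4, q 3),
                          (q 1, q 4), (q 2, q 3), (q 2, q 4), (q 3, q 4)}.
              R = opd.span {\<rho>\<^sub>1, \<rho>\<^sub>2})))"
proof (intro conjI allI impI)
  fix R :: "'f opd set" and A f
  assume "quadratic_relations 2 R"
  then show "17 \<le> cubic_rank R"
    by (rule rank_ge_17)
  show "cubic_rank R \<le> 22"
    by (rule cubic_rank_le)
next
  show "zariski_dense 4 {vec_of_list [a, b, c, d] | a b c d.
      \<exists>R. quadratic_relations 2 R \<and> row_canonical_form R (M a b c d) \<and> cubic_rank R = 22}"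
    unfolding M_def by (rule rank_22_dense)
next
  fix R :: "'f opd set" and a b c d
  assume "quadratic_relations 2 R \<and> row_canonical_form R (M a b c d) \<and> cubic_rank R = 22"
  then show "quotient_nilpotent (ideal_gen R) 3"
    using nilpotent_iff[of 2 R] by simp
next
  fix R :: "'f opd set" and A f
  assume *: "quadratic_relations 2 R \<and> row_canonical_form R A \<and> pivot_fun A f 4 \<and> {f 0, f 1} \<noteq> {0, 1}"
  show "cubic_rank R \<noteq> 22"
    by (rule rank_22_only_pivots_12[of R A f]) (use * in simp_all)
  with * show "\<not> quotient_nilpotent (ideal_gen R) 3"
    using nilpotent_iff[of 2 R] by simp
next
  fix R :: "'f opd set"
  assume "quadratic_relations 2 R"
  then show "cubic_rank R = 17 \<longleftrightarrow>
      (\<exists>(\<rho>\<^sub>1, \<rho>\<^sub>2) \<in> {(q 1, q 2), (q 1 - q 4, q 2), (q 1, q 3), (q 1 - q 4, q 3),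
        (q 1, q 4), (q 2, q 3), (q 2, q 4), (q 3, q 4)}. R = opd.span {\<rho>\<^sub>1, \<rho>\<^sub>2})"
    unfolding q_def by (rule rank_17_iff)
qed

end
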